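(* Let $0<p<1$, let $n$ be a positive integer, and let $f:(\{0,1\}^n,\mu_p^n)\to\{0,1\}$ be a function. For every $\epsilon>0$, there exists an $e^{10^{10}\epsilon^{-2}\lceil I_f\rceil^2}$-pseudo-junta $h:(\{0,1\}^n,\mu_p^n)\to\{0,1\}$ such that $\|f-h\|_1\le\epsilon$.
   Context: $\mu_p$ is the Bernoulli distribution on $\{0,1\}$ with $\mu_p(\{1\})=p$, $\mu_p(\{0\})=1-p$, and $\mu_p^n$ is the product measure on $\{0,1\}^n$. Integrals and norms are with respect to $\mu_p^n$. Write $[n]=\{1,\dots,n\}$, $\mathcal{P}([n])$ for the set of subsets of $[n]$, and $x_S=(x_i)_{i\in S}$ for $x\in\{0,1\}^n$, $S\subseteq[n]$. Influence: for $j\in[n]$, $I_f(j)=\Pr[f(x_1,\dots,x_n)\ne f(x_1,\dots,x_{j-1},y_j,x_{j+1},\dots,x_n)]$, where $x_1,\dots,x_n,y_1,\dots,y_n$ are i.i.d. with law $\mu_p$. The total influence is $I_f=\sum_{j=1}^n I_f(j)$. Pseudo-juntas: let $\mathcal{J}=\{J_S\}_{S\subseteq[n]}$ be a collection of functions $J_S:\{0,1\}^S\to\{0,1\}$. Define $J_{\mathcal{J}}:\{0,1\}^n\to\mathcal{P}([n])$ by $J_{\mathcal{J}}(x)=\bigcup_{S\subseteq[n]:\,J_S(x_S)=1}S$. Let $\mathcal{F}_{\mathcal{J}}$ be the $\sigma$-algebra on $\{0,1\}^n$ induced by the map $x\mapsto(J_{\mathcal{J}}(x),x_{J_{\mathcal{J}}(x)})$,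 i.e. the coarsest $\sigma$-algebra making this map measurable. For a constant $k>0$, a $k$-pseudo-junta is a function $h:\{0,1\}^n\to\{0,1\}$ that is measurable with respect to $\mathcal{F}_{\mathcal{J}}$ for some such $\mathcal{J}$ satisfying $\int|J_{\mathcal{J}}(x)|\,d\mu_p^n(x)\le k$, where $|\cdot|$ denotes cardinality. *)

theory Defs
  imports "HOL-Probability.Probability"
begin

text \<open>
  The two-element set of bits is represented by \<open>bool\<close>, with \<open>True\<close> as 1 and \<open>False\<close> as 0.
  A point of \<open>{0,1}\<^sup>S\<close> is a function on \<open>S\<close> that is \<open>undefined\<close> outside \<open>S\<close>, so the
  subtuple \<open>x\<^sub>S\<close> is \<open>restrict x S\<close>, and a function on \<open>{0,1}\<^sup>S\<close> is a HOL function whose values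
  off \<open>cube S\<close> are irrelevant.
\<close>

definition cube :: "nat set \<Rightarrow> (nat \<Rightarrow> bool) set" where
  "cube S = (\<Pi>\<^sub>E i\<in>S. UNIV)"

text \<open>
  The default value \<open>undefined\<close> makes \<open>cube {1..n}\<close> the support of this distribution
  (for \<open>0 < p < 1\<close>).
\<close>

definition mu :: "real \<Rightarrow> nat \<Rightarrow> (nat \<Rightarrow> bool) pmf" where
  "mu p n = Pi_pmf {1..n} undefined (\<lambda>_. bernoulli_pmf p)"

definition influence :: "real \<Rightarrow> nat \<Rightarrow> ((nat \<Rightarrow> bool) \<Rightarrow> bool) \<Rightarrow> nat \<Rightarrow> real" where
  "influence p n f j =
     measure_pmf.prob (pair_pmf (mu p n) (mu p n)) {(x, y). f x \<noteq> f (x(j := y j))}"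

definition total_influence :: "real \<Rightarrow> nat \<Rightarrow> ((nat \<Rightarrow> bool) \<Rightarrow> bool) \<Rightarrow> real" where
  "total_influence p n f = (\<Sum>j=1..n. influence p n f j)"

definition junta_set ::
  "nat \<Rightarrow> (nat set \<Rightarrow> (nat \<Rightarrow> bool) \<Rightarrow> bool) \<Rightarrow> (nat \<Rightarrow> bool) \<Rightarrow> nat set" where
  "junta_set n J x = \<Union>{S. S \<subseteq> {1..n} \<and> J S (restrict x S)}"

text \<open>
  The target of \<open>x \<mapsto> (J(x), x\<^bsub>J(x)\<^esub>)\<close> is a finite set and carries the discrete \<open>\<sigma>\<close>-algebra.
\<close>

definition junta_algebra ::
  "nat \<Rightarrow> (nat set \<Rightarrow> (nat \<Rightarrow> bool) \<Rightarrow> bool) \<Rightarrow> (nat \<Rightarrow> bool) measure" where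
  "junta_algebra n J =
     vimage_algebra (cube {1..n})
       (\<lambda>x. (junta_set n J x, restrict x (junta_set n J x)))
       (count_space (SIGMA S:Pow {1..n}. cube S))"

definition pseudo_junta :: "real \<Rightarrow> nat \<Rightarrow> real \<Rightarrow> ((nat \<Rightarrow> bool) \<Rightarrow> bool) \<Rightarrow> bool" where
  "pseudo_junta p n k h \<longleftrightarrow>
     k > 0 \<and>
     (\<exists>J. h \<in> measurable (junta_algebra n J) (count_space UNIV) \<and>
          measure_pmf.expectation (mu p n) (\<lambda>x. real (card (junta_set n J x))) \<le> k)"

end

theory Submission
  imports Defs
begin

text \<open>
  Let \<open>q \<le> 1/2\<close> be the probability of the rarer bit value, and encode a point of the cube by the set
  \<open>X\<close> of coordinates carrying that value. Expand \<open>f = \<Sum>\<^sub>T \<alpha>\<^sub>T \<chi>\<^sub>T\<close> with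
  \<open>\<chi>\<^sub>T(X) = \<Prod>\<^bsub>i\<in>T\<^esub> (1[i \<in> X] - q)\<close> and \<open>s = q(1-q)\<close>, so that the weight of \<open>T\<close> is
  \<open>s\<^bsup>|T|\<^esup> \<alpha>\<^sub>T\<^sup>2\<close>. Small influence makes the weight above level \<open>d \<sim> I/\<epsilon>\<close> negligible.

  Call \<open>S\<close> active if the weight of all \<open>T \<supseteq> S\<close> of size at most \<open>d\<close> is at least \<open>\<delta> s\<^bsup>|S|\<^esup>\<close>, and
  let \<open>J\<^sub>S(x) = 1\<close> iff \<open>S\<close> is active and \<open>x\<close> is rare on all of \<open>S\<close>. If some \<open>j \<in> T\<close> lies in no active
  subset of \<open>T\<close>, then \<open>T\<close> contributes to the part \<open>H\<^sub>j\<close> of the \<open>j\<close>-th derivative \<open>D\<^sub>jf\<close> all of whose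
  restrictions are small, and a fourth-moment inequality with constants independent of \<open>p\<close> bounds
  \<open>E H\<^sub>j\<^sup>4\<close>. Since \<open>D\<^sub>jf\<close> is as small in \<open>L\<^sup>1\<close> as in \<open>L\<^sup>2\<close> squared, two uses of Cauchy-Schwarz show that such \<open>T\<close>
  carry little weight. So \<open>f\<close> is close to the sum of the \<open>\<alpha>\<^sub>T \<chi>\<^sub>T\<close> over the unions \<open>T\<close> of active sets.

  These \<open>\<chi>\<^sub>T\<close> are not yet measurable, because \<open>\<chi>\<^sub>T\<close> involves the indicators of \<open>Z \<subseteq> X\<close> for all
  \<open>Z \<subseteq> T\<close>. One replaces each indicator by its conditional expectation given the union \<open>Z\<degree>\<close> of the
  active subsets of \<open>Z\<close>. For the error to be small, the family of active sets is first enlarged such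
  that for every inactive \<open>U\<close> the expected number of active \<open>S \<supset> U\<close> with \<open>S \<subseteq> X\<close>, given
  \<open>U \<subseteq> X\<close>, is at most \<open>\<gamma> = 2\<^bsup>-O(d)\<^esup>\<close>. Doing this level by level multiplies the expected number of
  active sets by \<open>2\<^bsup>O(d)\<^esup>\<close> for each of the \<open>d\<close> levels, whence the bound \<open>exp(O(d\<^sup>2))\<close>.
\<close>

subsection \<open>Characters of the biased cube\<close>

text \<open>The expectation of \<open>\<phi> X\<close> when \<open>X\<close> contains each point of
  \<open>N\<close> independently with probability \<open>q\<close>.\<close>

definition bmean :: "real \<Rightarrow> 'a set \<Rightarrow> ('a set \<Rightarrow> real) \<Rightarrow> real" where
  "bmean q N \<phi> = (\<Sum>X\<in>Pow N. q ^ card X * (1 - q) ^ card (N - X) * \<phi> X)"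

text \<open>Left unnormalised: each factor has mean 0 and variance \<open>q * (1 - q)\<close>, so
  weights carry \<open>(q * (1 - q)) ^ card T\<close> and no square roots appear in the
  coefficients.\<close>

definition chr :: "real \<Rightarrow> 'a set \<Rightarrow> 'a set \<Rightarrow> real" where
  "chr q T X = (\<Prod>i\<in>T. of_bool (i \<in> X) - q)"

definition expansion :: "real \<Rightarrow> 'a set \<Rightarrow> ('a set \<Rightarrow> real) \<Rightarrow> 'a set \<Rightarrow> real" where
  "expansion q N \<alpha> X = (\<Sum>T\<in>Pow N. \<alpha> T * chr q T X)"

lemma sum_Pow_insert:
  assumes "finite N" "i \<notin> N"
  shows "(\<Sum>X\<in>Pow (insert i N). \<phi> X) = (\<Sum>X\<in>Pow N. \<phi> X + \<phi> (insert i X) :: 'b::comm_monoid_add)"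
proof -
  have "inj_on (insert i) (Pow N)"
    using assms(2) by (intro inj_onI) (metis PowD insert_ident subsetD)
  moreover have "Pow N \<inter> insert i ` Pow N = {}"
    using assms(2) by auto
  ultimately show ?thesis
    using assms(1) by (simp add: Pow_insert sum.union_disjoint sum.reindex sum.distrib)
qed

lemma bmean_empty [simp]: "bmean q {} \<phi> = \<phi> {}"
  by (simp add: bmean_def)

text \<open>Conditioning on whether \<open>i\<close> lies in \<open>X\<close>; all inductions over
  the coordinates rest on this.\<close>

lemma bmean_insert:
  assumes "finite N" "i \<notin> N"
  shows "bmean q (insert i N) \<phi> = bmean q N (\<lambda>X. q * \<phi> (insert i X) + (1 - q) * \<phi> X)"
  unfolding bmean_def sum_Pow_insert[OF assms]
proof (rule sum.cong)
  fix X assume "X \<in> Pow N"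
  then have X: "X \<subseteq> N" "finite X" "i \<notin> X"
    using assms finite_subset by auto
  have "insert i N - insert i X = N - X" "insert i N - X = insert i (N - X)"
    using X assms by auto
  then have "card (insert i N - insert i X) = card (N - X)"
    "card (insert i N - X) = Suc (card (N - X))" "card (insert i X) = Suc (card X)"
    using X assms by auto
  then show "q ^ card X * (1 - q) ^ card (insert i N - X) * \<phi> X +
      q ^ card (insert i X) * (1 - q) ^ card (insert i N - insert i X) * \<phi> (insert i X) =
      q ^ card X * (1 - q) ^ card (N - X) * (q * \<phi> (insert i X) + (1 - q) * \<phi> X)"
    by (simp add: algebra_simps)
qed simp

lemma bmean_cong: "(\<And>X. X \<subseteq> N \<Longrightarrow> \<phi> X = \<psi> X) \<Longrightarrow> bmean q N \<phi> = bmean q N \<psi>"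
  by (simp add: bmean_def)

lemma bmean_mono:
  assumes "0 \<le> q" "q \<le> 1" "\<And>X. X \<subseteq> N \<Longrightarrow> \<phi> X \<le> \<psi> X"
  shows "bmean q N \<phi> \<le> bmean q N \<psi>"
  unfolding bmean_def using assms by (intro sum_mono mult_left_mono) auto

lemma bmean_nonneg:
  assumes "0 \<le> q" "q \<le> 1" "\<And>X. X \<subseteq> N \<Longrightarrow> 0 \<le> \<phi> X"
  shows "0 \<le> bmean q N \<phi>"
  unfolding bmean_def using assms by (intro sum_nonneg mult_nonneg_nonneg) auto

lemma bmean_add: "bmean q N (\<lambda>X. \<phi> X + \<psi> X) = bmean q N \<phi> + bmean q N \<psi>"
  by (simp add: bmean_def algebra_simps sum.distrib)

lemma bmean_diff: "bmean q N (\<lambda>X. \<phi> X - \<psi> X) = bmean q N \<phi> - bmean q N \<psi>"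
  by (simp add: bmean_def algebra_simps sum_subtractf)

lemma bmean_cmult: "bmean q N (\<lambda>X. c * \<phi> X) = c * bmean q N \<phi>"
  by (simp add: bmean_def algebra_simps sum_distrib_left)

lemma bmean_sum: "bmean q N (\<lambda>X. \<Sum>a\<in>A. \<phi> a X) = (\<Sum>a\<in>A. bmean q N (\<phi> a))"
  unfolding bmean_def by (simp add: sum_distrib_left) (rule sum.swap)

lemma bmean_indicator:
  assumes "finite N" "S \<subseteq> N"
  shows "bmean q N (\<lambda>X. of_bool (S \<subseteq> X)) = q ^ card S"
  using assms
proof (induction N arbitrary: S rule: finite_induct)
  case empty
  then show ?case by simp
next
  case (insert i N)
  have fS: "finite S" using insert.hyps insert.prems finite_subset by blast
  have *: "S \<subseteq> insert i X \<longleftrightarrow> S - {i} \<subseteq> X" for X by auto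
  have "bmean q N (\<lambda>X. of_bool (S - {i} \<subseteq> X)) = q ^ card (S - {i})"
    using insert.prems by (intro insert.IH) auto
  moreover have "bmean q N (\<lambda>X. of_bool (S \<subseteq> X)) = (if i \<in> S then 0 else q ^ card S)"
  proof (cases "i \<in> S")
    case True
    then have "\<not> S \<subseteq> X" if "X \<subseteq> N" for X using insert.hyps that by auto
    then have "bmean q N (\<lambda>X. of_bool (S \<subseteq> X)) = bmean q N (\<lambda>X. 0)"
      by (intro bmean_cong) auto
    then show ?thesis using True by (simp add: bmean_def)
  next
    case False
    then show ?thesis using insert.prems insert.IH[of S] by auto
  qed
  moreover have "q * q ^ card (S - {i}) = q ^ card S" if "i \<in> S"
    using card.remove[OF fS that] by (metis power_Suc)
  ultimately show ?case
    unfolding bmean_insert[OF insert.hyps(1,2)] bmean_add bmean_cmult *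
    by (cases "i \<in> S") (simp_all add: algebra_simps)
qed

lemma bmean_const: "finite N \<Longrightarrow> bmean q N (\<lambda>X. c) = c"
  using bmean_indicator[of N "{}" q] bmean_cmult[of q N c "\<lambda>_. 1"] by simp

lemma bmean_Cauchy_Schwarz:
  assumes "0 \<le> q" "q \<le> 1"
  shows "(bmean q N (\<lambda>X. \<phi> X * \<psi> X))\<^sup>2 \<le> bmean q N (\<lambda>X. (\<phi> X)\<^sup>2) * bmean q N (\<lambda>X. (\<psi> X)\<^sup>2)"
proof -
  define w where "w X = q ^ card X * (1 - q) ^ card (N - X)" for X
  have w: "w X \<ge> 0" for X using assms by (simp add: w_def)
  have "(\<Sum>X\<in>Pow N. (sqrt (w X) * \<phi> X) * (sqrt (w X) * \<psi> X))\<^sup>2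
      \<le> (\<Sum>X\<in>Pow N. (sqrt (w X) * \<phi> X)\<^sup>2) * (\<Sum>X\<in>Pow N. (sqrt (w X) * \<psi> X)\<^sup>2)"
    by (rule Cauchy_Schwarz_ineq_sum)
  moreover have "(sqrt (w X) * \<phi> X) * (sqrt (w X) * \<psi> X) = w X * (\<phi> X * \<psi> X)" for X
  proof -
    have "(sqrt (w X) * \<phi> X) * (sqrt (w X) * \<psi> X) = (sqrt (w X) * sqrt (w X)) * (\<phi> X * \<psi> X)"
      by (simp only: mult_ac)
    then show ?thesis using w[of X] by simp
  qed
  moreover have "(sqrt (w X) * u)\<^sup>2 = w X * u\<^sup>2" for X u
    using w[of X] by (simp add: power_mult_distrib)
  ultimately show ?thesis
    by (simp only: bmean_def flip: w_def)
qed

lemma chr_empty [simp]: "chr q {} X = 1"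
  by (simp add: chr_def)

lemma chr_insert:
  "finite T \<Longrightarrow> i \<notin> T \<Longrightarrow> chr q (insert i T) X = (of_bool (i \<in> X) - q) * chr q T X"
  by (simp add: chr_def)

lemma chr_insert_point: "i \<notin> T \<Longrightarrow> chr q T (insert i X) = chr q T X"
  unfolding chr_def by (rule prod.cong) auto

lemma chr_remove_point: "i \<notin> T \<Longrightarrow> chr q T (X - {i}) = chr q T X"
  unfolding chr_def by (rule prod.cong) auto

lemma expansion_insert:
  assumes "finite N" "i \<notin> N"
  shows "expansion q (insert i N) \<alpha> X =
    expansion q N \<alpha> X + (of_bool (i \<in> X) - q) * expansion q N (\<lambda>T. \<alpha> (insert i T)) X"
proof -
  have "chr q (insert i T) X = (of_bool (i \<in> X) - q) * chr q T X" if "T \<subseteq> N" for T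
    using that assms finite_subset by (intro chr_insert) auto
  then have "(\<Sum>T\<in>Pow N. \<alpha> (insert i T) * chr q (insert i T) X) =
      (\<Sum>T\<in>Pow N. (of_bool (i \<in> X) - q) * (\<alpha> (insert i T) * chr q T X))"
    by (intro sum.cong) auto
  then show ?thesis
    by (simp only: expansion_def sum_Pow_insert[OF assms] sum.distrib sum_distrib_left)
qed

lemma expansion_insert_point:
  "i \<notin> N \<Longrightarrow> expansion q N \<alpha> (insert i X) = expansion q N \<alpha> X"
  unfolding expansion_def by (rule sum.cong) (auto intro!: chr_insert_point)

lemma expansion_cong:
  "(\<And>T. T \<subseteq> N \<Longrightarrow> \<alpha> T = \<beta> T) \<Longrightarrow> expansion q N \<alpha> X = expansion q N \<beta> X"
  by (simp add: expansion_def)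

text \<open>By induction over the coordinates: a centred factor has mean 0, which removes the cross
  terms, and second moment \<open>q * (1 - q)\<close>, which supplies the weight.\<close>

lemma Parseval:
  assumes "finite N"
  shows "bmean q N (\<lambda>X. expansion q N \<alpha> X * expansion q N \<beta> X) =
    (\<Sum>T\<in>Pow N. (q * (1 - q)) ^ card T * (\<alpha> T * \<beta> T))"
  using assms
proof (induction N arbitrary: \<alpha> \<beta> rule: finite_induct)
  case empty
  then show ?case by (simp add: expansion_def)
next
  case (insert i N)
  let ?a = "\<lambda>T. \<alpha> (insert i T)" and ?b = "\<lambda>T. \<beta> (insert i T)"
  have "bmean q (insert i N) (\<lambda>X. expansion q (insert i N) \<alpha> X * expansion q (insert i N) \<beta> X) =
    bmean q N (\<lambda>X. expansion q N \<alpha> X * expansion q N \<beta> X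
      + q * (1 - q) * (expansion q N ?a X * expansion q N ?b X))"
    unfolding bmean_insert[OF insert.hyps(1,2)]
  proof (rule bmean_cong)
    fix X assume "X \<subseteq> N"
    then have "i \<notin> X" using insert.hyps by auto
    then show "q * (expansion q (insert i N) \<alpha> (insert i X) * expansion q (insert i N) \<beta> (insert i X))
      + (1 - q) * (expansion q (insert i N) \<alpha> X * expansion q (insert i N) \<beta> X) =
      expansion q N \<alpha> X * expansion q N \<beta> X
      + q * (1 - q) * (expansion q N ?a X * expansion q N ?b X)"
      by (simp add: expansion_insert[OF insert.hyps(1,2)] expansion_insert_point insert.hyps
          algebra_simps)
  qed
  also have "\<dots> = (\<Sum>T\<in>Pow N. (q * (1 - q)) ^ card T * (\<alpha> T * \<beta> T)) +
      q * (1 - q) * (\<Sum>T\<in>Pow N. (q * (1 - q)) ^ card T * (?a T * ?b T))"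
    by (simp add: bmean_add bmean_cmult insert.IH)
  also have "\<dots> = (\<Sum>T\<in>Pow N. (q * (1 - q)) ^ card T * (\<alpha> T * \<beta> T) +
      (q * (1 - q)) ^ card (insert i T) * (?a T * ?b T))"
    unfolding sum_distrib_left sum.distrib
  proof (rule arg_cong2[where f = "(+)"])
    have "card (insert i T) = Suc (card T)" if "T \<subseteq> N" for T
      using that insert.hyps finite_subset by (subst card_insert_disjoint) auto
    then show "(\<Sum>T\<in>Pow N. q * (1 - q) * ((q * (1 - q)) ^ card T * (?a T * ?b T))) =
      (\<Sum>T\<in>Pow N. (q * (1 - q)) ^ card (insert i T) * (?a T * ?b T))"
      by (intro sum.cong) (auto simp: mult_ac)
  qed simp
  finally show ?case
    by (simp add: sum_Pow_insert[OF insert.hyps(1,2)])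
qed

lemma expansion_exists:
  assumes "finite N"
  shows "\<exists>\<alpha>. \<forall>X\<subseteq>N. \<phi> X = expansion q N \<alpha> X"
  using assms
proof (induction N arbitrary: \<phi> rule: finite_induct)
  case empty
  then show ?case by (auto simp: expansion_def)
next
  case (insert i N)
  \<comment> \<open>The average over coordinate \<open>i\<close> gives the coefficients of the sets
    without \<open>i\<close>, the discrete derivative those of the sets with
    \<open>i\<close>.\<close>
  obtain \<alpha>0 where a0: "\<forall>X\<subseteq>N. q * \<phi> (insert i X) + (1 - q) * \<phi> X = expansion q N \<alpha>0 X"
    using insert.IH[of "\<lambda>X. q * \<phi> (insert i X) + (1 - q) * \<phi> X"] by blast
  obtain \<alpha>1 where a1: "\<forall>X\<subseteq>N. \<phi> (insert i X) - \<phi> X = expansion q N \<alpha>1 X"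
    using insert.IH[of "\<lambda>X. \<phi> (insert i X) - \<phi> X"] by blast
  define \<alpha> where "\<alpha> T = (if i \<in> T then \<alpha>1 (T - {i}) else \<alpha>0 T)" for T
  have 0: "expansion q N \<alpha> X = expansion q N \<alpha>0 X" for X
    using insert.hyps by (intro expansion_cong) (auto simp: \<alpha>_def)
  have 1: "expansion q N (\<lambda>T. \<alpha> (insert i T)) X = expansion q N \<alpha>1 X" for X
  proof (rule expansion_cong)
    fix T assume "T \<subseteq> N"
    then have "insert i T - {i} = T" using insert.hyps by auto
    then show "\<alpha> (insert i T) = \<alpha>1 T" by (simp add: \<alpha>_def)
  qed
  have e: "expansion q N \<alpha>0 Y = q * \<phi> (insert i Y) + (1 - q) * \<phi> Y"
    "expansion q N \<alpha>1 Y = \<phi> (insert i Y) - \<phi> Y" if "Y \<subseteq> N" for Y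
    using a0 a1 that by auto
  have "\<phi> X = expansion q (insert i N) \<alpha> X" if "X \<subseteq> insert i N" for X
  proof (cases "i \<in> X")
    case True
    define Y where "Y = X - {i}"
    have Y: "insert i Y = X" "Y \<subseteq> N" using that True by (auto simp: Y_def)
    have "expansion q (insert i N) \<alpha> (insert i Y) = \<phi> (insert i Y)"
      unfolding expansion_insert[OF insert.hyps(1,2)] 0 1
        expansion_insert_point[OF insert.hyps(2)] e[OF Y(2)]
      by (simp add: algebra_simps)
    then show ?thesis using Y(1) by simp
  next
    case False
    then have "X \<subseteq> N" using that by auto
    then show ?thesis
      unfolding expansion_insert[OF insert.hyps(1,2)] 0 1 e[OF \<open>X \<subseteq> N\<close>]
      using False by (simp add: algebra_simps)
  qed
  then show ?case by blast
qed

subsection \<open>The fourth moment\<close>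

text \<open>The one-coordinate case, for the functions \<open>a + (x - q) * b\<close> and
  \<open>c + (x - q) * e\<close> of a biased bit \<open>x\<close>. The last term is only of order
  \<open>q * (1 - q)\<close>, not its square, because the fourth central moment of \<open>x\<close>
  is of that order when \<open>q\<close> is small.\<close>

lemma two_point_fourth_moment:
  fixes q :: real
  assumes "0 \<le> q" "q \<le> 1"
  shows "q * ((a + (1 - q) * b)\<^sup>2 * (c + (1 - q) * e)\<^sup>2) + (1 - q) * ((a - q * b)\<^sup>2 * (c - q * e)\<^sup>2)
    \<le> a\<^sup>2 * c\<^sup>2 + 4 * (q * (1 - q)) * (a\<^sup>2 * e\<^sup>2 + b\<^sup>2 * c\<^sup>2) + 16 * (q * (1 - q)) * (b\<^sup>2 * e\<^sup>2)"
proof -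
  define s where "s = q * (1 - q)"
  have s: "0 \<le> s" using assms by (auto simp: s_def)
  define A where "A = a\<^sup>2 * e\<^sup>2 + b\<^sup>2 * c\<^sup>2"
  define B where "B = b\<^sup>2 * e\<^sup>2"
  \<comment> \<open>These are the terms with the third central moment
    \<open>s * (1 - 2 * q)\<close>. Since \<open>1 - 2 * q\<close> lies between -1 and 1, they are
    absorbed by squares. The fourth central moment is \<open>s * (1 - 3 * s)\<close>.\<close>
  define D where "D = (1 - 2 * q) * (2 * (a * e) * (b * e)) + (1 - 2 * q) * (2 * (b * c) * (b * e))"
  have eq: "q * ((a + (1 - q) * b)\<^sup>2 * (c + (1 - q) * e)\<^sup>2) + (1 - q) * ((a - q * b)\<^sup>2 * (c - q * e)\<^sup>2)
    = a\<^sup>2 * c\<^sup>2 + s * (A + 2 * (2 * (a * e) * (b * c)) + D + (1 - 3 * s) * B)"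
    unfolding s_def A_def B_def D_def by (simp add: algebra_simps power2_eq_square)
  have 1: "2 * (a * e) * (b * c) \<le> A"
    using sum_squares_bound[of "a * e" "b * c"] by (simp add: A_def power_mult_distrib)
  have odd: "(1 - 2 * q) * (2 * u * v) \<le> u\<^sup>2 + v\<^sup>2" for u v :: real
  proof -
    have "q * (u - v)\<^sup>2 \<ge> 0" "q * (u + v)\<^sup>2 \<ge> 0" "(1 - q) * (u - v)\<^sup>2 \<ge> 0"
      using assms by auto
    then show ?thesis by (simp add: algebra_simps power2_eq_square)
  qed
  have 2: "D \<le> A + 2 * B"
    using odd[of "a * e" "b * e"] odd[of "b * c" "b * e"]
    by (simp add: A_def B_def D_def power_mult_distrib)
  have "0 \<le> B" "0 \<le> s * B"
    using s by (simp_all add: B_def)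
  then have 3: "(1 - 3 * s) * B \<le> B" "0 \<le> B"
    by (simp_all add: algebra_simps)
  \<comment> \<open>The coefficient 16 is generous; it equals the
    \<open>(4 * s) * (4 * s) / s\<close> that the induction over coordinates provides, up to the
    common factor \<open>s\<close>.\<close>
  have "A + 2 * (2 * (a * e) * (b * c)) + D + (1 - 3 * s) * B \<le> 4 * A + 16 * B"
    using 1 2 3 by linarith
  from mult_left_mono[OF this s] show ?thesis
    unfolding eq s_def[symmetric] A_def[symmetric] B_def[symmetric] by (simp add: algebra_simps)
qed

text \<open>The weight of the supersets of \<open>S\<close>; the factor 4 per element pays for the
  constants of \<open>two_point_fourth_moment\<close>.\<close>

definition upweight :: "real \<Rightarrow> 'a set \<Rightarrow> ('a set \<Rightarrow> real) \<Rightarrow> 'a set \<Rightarrow> real" where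
  "upweight s N \<alpha> S = (\<Sum>T\<in>Pow N. of_bool (S \<subseteq> T) * ((4 * s) ^ card T * (\<alpha> T)\<^sup>2))"

lemma upweight_insert:
  assumes "finite N" "i \<notin> N" "S \<subseteq> N"
  shows "upweight s (insert i N) \<alpha> S = upweight s N \<alpha> S + 4 * s * upweight s N (\<lambda>T. \<alpha> (insert i T)) S"
    and "upweight s (insert i N) \<alpha> (insert i S) = 4 * s * upweight s N (\<lambda>T. \<alpha> (insert i T)) S"
proof -
  have c: "card (insert i T) = Suc (card T)" if "T \<subseteq> N" for T
    using that assms finite_subset by (subst card_insert_disjoint) auto
  have i: "i \<notin> S" using assms by auto
  then have eq: "S \<subseteq> insert i T \<longleftrightarrow> S \<subseteq> T" "insert i S \<subseteq> insert i T \<longleftrightarrow> S \<subseteq> T" for T by auto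
  have n: "\<not> insert i S \<subseteq> T" if "T \<subseteq> N" for T using that assms by auto
  have z: "(\<Sum>T\<in>Pow N. of_bool (insert i S \<subseteq> T) * ((4 * s) ^ card T * (\<alpha> T)\<^sup>2)) = 0"
    by (rule sum.neutral) (use n in simp)
  show "upweight s (insert i N) \<alpha> S = upweight s N \<alpha> S + 4 * s * upweight s N (\<lambda>T. \<alpha> (insert i T)) S"
    unfolding upweight_def sum_Pow_insert[OF assms(1,2)] sum.distrib sum_distrib_left
    by (intro arg_cong2[where f = "(+)"] sum.cong) (auto simp: c eq mult_ac)
  show "upweight s (insert i N) \<alpha> (insert i S) = 4 * s * upweight s N (\<lambda>T. \<alpha> (insert i T)) S"
    unfolding upweight_def sum_Pow_insert[OF assms(1,2)] sum.distrib z add_0 sum_distrib_left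
    by (intro sum.cong) (auto simp: c eq mult_ac)
qed

text \<open>The two-point inequality applied one coordinate at a time. Two functions are needed
  because splitting off \<open>i\<close> produces mixed pairs of \<open>\<alpha>\<close> and its
  derivative coefficients. No constant depends on \<open>q\<close>: the bias enters only through the
  weights above \<open>S\<close> relative to \<open>s ^ card S\<close>.\<close>

lemma global_hypercontractivity:
  assumes "finite N" "0 < q" "q < 1"
  defines "s \<equiv> q * (1 - q)"
  shows "bmean q N (\<lambda>X. (expansion q N \<alpha> X)\<^sup>2 * (expansion q N \<beta> X)\<^sup>2)
    \<le> (\<Sum>S\<in>Pow N. upweight s N \<alpha> S * upweight s N \<beta> S / s ^ card S)"
  using assms(1)
proof (induction N arbitrary: \<alpha> \<beta> rule: finite_induct)
  case empty
  then show ?case by (simp add: expansion_def upweight_def)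
next
  case (insert i N)
  have s: "s > 0" using assms by (simp add: s_def)
  let ?a = "\<lambda>T. \<alpha> (insert i T)" and ?b = "\<lambda>T. \<beta> (insert i T)"
  define m where "m \<alpha> \<beta> = bmean q N (\<lambda>X. (expansion q N \<alpha> X)\<^sup>2 * (expansion q N \<beta> X)\<^sup>2)" for \<alpha> \<beta>
  define \<Psi> where "\<Psi> \<alpha> \<beta> = (\<Sum>S\<in>Pow N. upweight s N \<alpha> S * upweight s N \<beta> S / s ^ card S)" for \<alpha> \<beta>
  have IH: "m \<alpha> \<beta> \<le> \<Psi> \<alpha> \<beta>" for \<alpha> \<beta>
    unfolding m_def \<Psi>_def by (rule insert.IH)
  have "bmean q (insert i N) (\<lambda>X. (expansion q (insert i N) \<alpha> X)\<^sup>2 * (expansion q (insert i N) \<beta> X)\<^sup>2)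
    \<le> bmean q N (\<lambda>X. (expansion q N \<alpha> X)\<^sup>2 * (expansion q N \<beta> X)\<^sup>2
       + 4 * s * ((expansion q N \<alpha> X)\<^sup>2 * (expansion q N ?b X)\<^sup>2 + (expansion q N ?a X)\<^sup>2 * (expansion q N \<beta> X)\<^sup>2)
       + 16 * s * ((expansion q N ?a X)\<^sup>2 * (expansion q N ?b X)\<^sup>2))"
    unfolding bmean_insert[OF insert.hyps(1,2)]
  proof (rule bmean_mono)
    fix X assume "X \<subseteq> N"
    then have "i \<notin> X" using insert.hyps by auto
    then show "q * ((expansion q (insert i N) \<alpha> (insert i X))\<^sup>2 * (expansion q (insert i N) \<beta> (insert i X))\<^sup>2)
      + (1 - q) * ((expansion q (insert i N) \<alpha> X)\<^sup>2 * (expansion q (insert i N) \<beta> X)\<^sup>2)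
      \<le> (expansion q N \<alpha> X)\<^sup>2 * (expansion q N \<beta> X)\<^sup>2
       + 4 * s * ((expansion q N \<alpha> X)\<^sup>2 * (expansion q N ?b X)\<^sup>2 + (expansion q N ?a X)\<^sup>2 * (expansion q N \<beta> X)\<^sup>2)
       + 16 * s * ((expansion q N ?a X)\<^sup>2 * (expansion q N ?b X)\<^sup>2)"
      using two_point_fourth_moment[of q "expansion q N \<alpha> X" "expansion q N ?a X"
          "expansion q N \<beta> X" "expansion q N ?b X"] assms
      by (simp add: expansion_insert[OF insert.hyps(1,2)] expansion_insert_point insert.hyps)
  qed (use assms in auto)
  also have "\<dots> = m \<alpha> \<beta> + 4 * s * (m \<alpha> ?b + m ?a \<beta>) + 16 * s * m ?a ?b"
    by (simp add: bmean_add bmean_cmult m_def)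
  also have "\<dots> \<le> \<Psi> \<alpha> \<beta> + 4 * s * (\<Psi> \<alpha> ?b + \<Psi> ?a \<beta>) + 16 * s * \<Psi> ?a ?b"
    using s by (intro add_mono mult_left_mono IH) auto
  \<comment> \<open>The added nonnegative term comes from pairs of sets that both contain
    \<open>i\<close> while \<open>S\<close> does not. With it the right side is exactly the sum for
    \<open>insert i N\<close>, split by whether \<open>S\<close> contains \<open>i\<close>.\<close>
  also have "\<dots> \<le> \<Psi> \<alpha> \<beta> + 4 * s * (\<Psi> \<alpha> ?b + \<Psi> ?a \<beta>) + 16 * s * \<Psi> ?a ?b + 16 * s\<^sup>2 * \<Psi> ?a ?b"
    using s by (simp add: \<Psi>_def upweight_def sum_nonneg)
  also have "\<dots> = (\<Sum>S\<in>Pow N. upweight s (insert i N) \<alpha> S * upweight s (insert i N) \<beta> S / s ^ card S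
     + upweight s (insert i N) \<alpha> (insert i S) * upweight s (insert i N) \<beta> (insert i S) / s ^ card (insert i S))"
  proof -
    have "upweight s (insert i N) \<alpha> S * upweight s (insert i N) \<beta> S / s ^ card S
     + upweight s (insert i N) \<alpha> (insert i S) * upweight s (insert i N) \<beta> (insert i S) / s ^ card (insert i S)
     = upweight s N \<alpha> S * upweight s N \<beta> S / s ^ card S
      + 4 * s * (upweight s N \<alpha> S * upweight s N ?b S / s ^ card S + upweight s N ?a S * upweight s N \<beta> S / s ^ card S)
      + 16 * s * (upweight s N ?a S * upweight s N ?b S / s ^ card S)
      + 16 * s\<^sup>2 * (upweight s N ?a S * upweight s N ?b S / s ^ card S)" if "S \<subseteq> N" for S
    proof -
      have "card (insert i S) = Suc (card S)"
        using that insert.hyps finite_subset by (subst card_insert_disjoint) auto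
      then show ?thesis
        using s unfolding upweight_insert[OF insert.hyps(1,2) that]
        by (simp add: field_simps power2_eq_square)
    qed
    then show ?thesis
      unfolding \<Psi>_def sum_distrib_left sum.distrib[symmetric]
      by (intro sum.cong) simp_all
  qed
  finally show ?case
    by (simp add: sum_Pow_insert[OF insert.hyps(1,2)])
qed

subsection \<open>Saturated families\<close>

text \<open>Violating sets \<open>U\<close> are adjoined in order of decreasing size. The weight of
  those added at one level is charged to the active sets above them: each \<open>U\<close> receives
  at least \<open>\<gamma>\<close> times its own weight, and each active set has at most
  \<open>2 ^ d\<close> subsets. Hence a level costs a factor
  \<open>1 + 2 ^ d / \<gamma>\<close>.\<close>

lemma saturation:
  fixes N :: "'a set" and q \<gamma> :: real
  assumes fN: "finite N" and q: "0 < q" and \<gamma>: "0 < \<gamma>"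
    and A0: "\<And>S. S \<in> A0 \<Longrightarrow> S \<subseteq> N \<and> card S \<le> d"
  obtains A where "A0 \<subseteq> A" "\<And>S. S \<in> A \<Longrightarrow> S \<subseteq> N \<and> card S \<le> d"
    "\<And>U. U \<subseteq> N \<Longrightarrow> U \<notin> A \<Longrightarrow> (\<Sum>S\<in>{S\<in>A. U \<subset> S}. q ^ card (S - U)) \<le> \<gamma>"
    "(\<Sum>S\<in>A. q ^ card S) \<le> (1 + 2 ^ d / \<gamma>) ^ d * (\<Sum>S\<in>A0. q ^ card S)"
proof -
  have fin: "finite U" if "U \<subseteq> N" for U using that fN finite_subset by blast
  have "\<exists>A. A0 \<subseteq> A \<and> (\<forall>S\<in>A. S \<subseteq> N \<and> card S \<le> d) \<and>
    (\<forall>U\<subseteq>N. U \<notin> A \<longrightarrow> d - k \<le> card U \<longrightarrow> (\<Sum>S\<in>{S\<in>A. U \<subset> S}. q ^ card (S - U)) \<le> \<gamma>) \<and>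
    (\<Sum>S\<in>A. q ^ card S) \<le> (1 + 2 ^ d / \<gamma>) ^ k * (\<Sum>S\<in>A0. q ^ card S)" if "k \<le> d" for k
    using that
  proof (induction k)
    case 0
    \<comment> \<open>Initially only sets of size at least \<open>d\<close> are treated, and no
      active set properly contains one.\<close>
    have "\<not> U \<subset> S" if "d \<le> card U" "S \<in> A0" for U S
      using A0[OF that(2)] fin[of S] psubset_card_mono[of S U] that(1) by auto
    then have "(\<Sum>S\<in>{S\<in>A0. U \<subset> S}. q ^ card (S - U)) \<le> \<gamma>" if "d \<le> card U" for U
      using that \<gamma> by (subst sum.neutral) auto
    then show ?case using A0 by (intro exI[of _ A0]) auto
  next
    case (Suc k)
    then obtain A where A: "A0 \<subseteq> A" "\<And>S. S \<in> A \<Longrightarrow> S \<subseteq> N \<and> card S \<le> d"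
      and sat: "\<And>U. U \<subseteq> N \<Longrightarrow> U \<notin> A \<Longrightarrow> d - k \<le> card U \<Longrightarrow>
        (\<Sum>S\<in>{S\<in>A. U \<subset> S}. q ^ card (S - U)) \<le> \<gamma>"
      and wt: "(\<Sum>S\<in>A. q ^ card S) \<le> (1 + 2 ^ d / \<gamma>) ^ k * (\<Sum>S\<in>A0. q ^ card S)"
      by (meson Suc_leD)
    define M where "M = {U. U \<subseteq> N \<and> card U = d - Suc k \<and> U \<notin> A \<and>
      \<gamma> < (\<Sum>S\<in>{S\<in>A. U \<subset> S}. q ^ card (S - U))}"
    have finA: "finite A" using A(2) fN by (intro finite_subset[of A "Pow N"]) auto
    have finM: "finite M" using fN by (intro finite_subset[of M "Pow N"]) (auto simp: M_def)
    \<comment> \<open>The new sets have the smallest size treated so far, so none properly contains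
      such a \<open>U\<close>, and conditions secured earlier survive.\<close>
    have "(\<Sum>S\<in>{S\<in>A \<union> M. U \<subset> S}. q ^ card (S - U)) \<le> \<gamma>"
      if U: "U \<subseteq> N" "U \<notin> A \<union> M" "d - Suc k \<le> card U" for U
    proof -
      have "S \<notin> M" if "U \<subset> S" for S
        using that psubset_card_mono[of S U] fin[of S] U(3) by (auto simp: M_def)
      then have eq: "{S\<in>A \<union> M. U \<subset> S} = {S\<in>A. U \<subset> S}" by auto
      show ?thesis
      proof (cases "d - k \<le> card U")
        case True
        then show ?thesis unfolding eq using sat U by auto
      next
        case False
        then have "card U = d - Suc k" using U(3) by auto
        then show ?thesis unfolding eq using U by (auto simp: M_def)
      qed
    qed
    moreover have "(\<Sum>S\<in>A \<union> M. q ^ card S) \<le> (1 + 2 ^ d / \<gamma>) ^ Suc k * (\<Sum>S\<in>A0. q ^ card S)"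
    proof -
      have "(\<Sum>U\<in>M. q ^ card U * \<gamma>) \<le> (\<Sum>U\<in>M. \<Sum>S\<in>A. of_bool (U \<subseteq> S) * q ^ card S)"
      proof (rule sum_mono)
        fix U assume U: "U \<in> M"
        have "q ^ card U * \<gamma> \<le> q ^ card U * (\<Sum>S\<in>{S\<in>A. U \<subset> S}. q ^ card (S - U))"
          using U q by (intro mult_left_mono) (auto simp: M_def)
        also have "\<dots> = (\<Sum>S\<in>{S\<in>A. U \<subset> S}. q ^ card S)"
          unfolding sum_distrib_left
        proof (rule sum.cong)
          fix S assume "S \<in> {S\<in>A. U \<subset> S}"
          then have "U \<subseteq> S" "finite S" using A(2) fin by auto
          then have "card S = card U + card (S - U)"
            using card_Diff_subset[of U S] finite_subset[of U S] card_mono[of S U] by auto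
          then show "q ^ card U * q ^ card (S - U) = q ^ card S" by (simp add: power_add)
        qed simp
        also have "\<dots> = (\<Sum>S\<in>{S\<in>A. U \<subset> S}. of_bool (U \<subseteq> S) * q ^ card S)"
          by (rule sum.cong) auto
        also have "\<dots> \<le> (\<Sum>S\<in>A. of_bool (U \<subseteq> S) * q ^ card S)"
          using q finA by (intro sum_mono2) auto
        finally show "q ^ card U * \<gamma> \<le> \<dots>" .
      qed
      also have "\<dots> = (\<Sum>S\<in>A. (\<Sum>U\<in>M. of_bool (U \<subseteq> S)) * q ^ card S)"
        by (subst sum.swap) (simp add: sum_distrib_right)
      also have "\<dots> \<le> (\<Sum>S\<in>A. 2 ^ d * q ^ card S)"
      proof (intro sum_mono mult_right_mono)
        fix S assume S: "S \<in> A"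
        have "(\<Sum>U\<in>M. of_bool (U \<subseteq> S)) = real (card {U\<in>M. U \<subseteq> S})"
          using finM by (simp add: Int_def)
        also have "card {U\<in>M. U \<subseteq> S} \<le> card (Pow S)"
          using A(2)[OF S] fin by (intro card_mono) auto
        also have "real (card (Pow S)) \<le> 2 ^ d"
          using A(2)[OF S] fin by (simp add: card_Pow)
        finally show "(\<Sum>U\<in>M. of_bool (U \<subseteq> S)) \<le> (2 ^ d :: real)" by simp
      qed (use q in auto)
      finally have "(\<Sum>U\<in>M. q ^ card U) \<le> 2 ^ d / \<gamma> * (\<Sum>S\<in>A. q ^ card S)"
        using \<gamma> by (simp add: field_simps flip: sum_distrib_left sum_distrib_right)
      moreover have "(\<Sum>S\<in>A \<union> M. q ^ card S) = (\<Sum>S\<in>A. q ^ card S) + (\<Sum>U\<in>M. q ^ card U)"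
        using finA finM by (intro sum.union_disjoint) (auto simp: M_def)
      ultimately have "(\<Sum>S\<in>A \<union> M. q ^ card S) \<le> (1 + 2 ^ d / \<gamma>) * (\<Sum>S\<in>A. q ^ card S)"
        by (simp add: algebra_simps)
      also have "\<dots> \<le> (1 + 2 ^ d / \<gamma>) * ((1 + 2 ^ d / \<gamma>) ^ k * (\<Sum>S\<in>A0. q ^ card S))"
        using wt \<gamma> by (intro mult_left_mono) auto
      finally show ?thesis by (simp add: mult_ac)
    qed
    moreover have "S \<subseteq> N \<and> card S \<le> d" if "S \<in> A \<union> M" for S
      using that A(2) by (auto simp: M_def)
    ultimately show ?case
      using A(1) by (intro exI[of _ "A \<union> M"] conjI ballI allI impI) (blast | simp)+
  qed
  from this[of d] obtain A where "A0 \<subseteq> A" "\<forall>S\<in>A. S \<subseteq> N \<and> card S \<le> d"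
    "\<forall>U\<subseteq>N. U \<notin> A \<longrightarrow> (\<Sum>S\<in>{S\<in>A. U \<subset> S}. q ^ card (S - U)) \<le> \<gamma>"
    "(\<Sum>S\<in>A. q ^ card S) \<le> (1 + 2 ^ d / \<gamma>) ^ d * (\<Sum>S\<in>A0. q ^ card S)"
    by auto
  then show ?thesis by (intro that) blast+
qed

section \<open>Unions of active sets, and growth of a set by active sets\<close>

definition core :: "'a set set \<Rightarrow> 'a set \<Rightarrow> 'a set" where
  "core A Z = \<Union>{S\<in>A. S \<subseteq> Z}"

lemma core_subset: "core A Z \<subseteq> Z"
  by (auto simp: core_def)

lemma core_mono: "Z \<subseteq> Y \<Longrightarrow> core A Z \<subseteq> core A Y"
  by (auto simp: core_def)

text \<open>A union of active sets contained in \<open>X\<close> is already contained in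
  \<open>core A X\<close>. This makes the indicators used in \<open>core_chr\<close> functions of
  \<open>core A X\<close> alone.\<close>

lemma core_subset_core_iff: "core A Z \<subseteq> core A X \<longleftrightarrow> core A Z \<subseteq> X"
  by (auto simp: core_def)

text \<open>
  The sets \<open>T\<close> for which \<open>chr q V\<close> occurs in the error of \<open>chr q T\<close> grow out of \<open>V\<close> by adjoining active
  sets whose trace on the part reached so far is inactive; each step then costs a factor \<open>2\<^bsup>d\<^esup> \<gamma>\<close>.
\<close>

inductive reach :: "'a set set \<Rightarrow> 'a set \<Rightarrow> 'a set \<Rightarrow> bool" for A where
  refl: "reach A V V"
| step: "S \<in> A \<Longrightarrow> S \<inter> V \<notin> A \<Longrightarrow> \<not> S \<subseteq> V \<Longrightarrow> reach A (V \<union> S) T \<Longrightarrow> reach A V T"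

lemma reach_subset: "reach A V T \<Longrightarrow> V \<subseteq> T"
  by (induction rule: reach.induct) auto

text \<open>Active subsets of \<open>T\<close> with inactive trace are adjoined greedily;
  \<open>T - V\<close> shrinks each time. At the end every active subset of \<open>T\<close> has an
  active trace on \<open>Y\<close>.\<close>

lemma reach_closed:
  assumes "finite T" "V \<subseteq> T"
  shows "\<exists>Y. reach A V Y \<and> Y \<subseteq> T \<and> (\<forall>S\<in>A. S \<subseteq> T \<longrightarrow> S \<subseteq> Y \<or> S \<inter> Y \<in> A)"
  using assms
proof (induction "card (T - V)" arbitrary: V rule: less_induct)
  case less
  show ?case
  proof (cases "\<forall>S\<in>A. S \<subseteq> T \<longrightarrow> S \<subseteq> V \<or> S \<inter> V \<in> A")
    case True
    with less.prems(2) show ?thesis by (intro exI[of _ V] conjI reach.refl)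
  next
    case False
    then obtain S where S: "S \<in> A" "S \<subseteq> T" "\<not> S \<subseteq> V" "S \<inter> V \<notin> A" by blast
    have "card (T - (V \<union> S)) < card (T - V)"
      using S less.prems by (intro psubset_card_mono) auto
    moreover have "V \<union> S \<subseteq> T" using S less.prems by simp
    ultimately obtain Y where Y: "reach A (V \<union> S) Y"
      "Y \<subseteq> T \<and> (\<forall>S\<in>A. S \<subseteq> T \<longrightarrow> S \<subseteq> Y \<or> S \<inter> Y \<in> A)"
      using less.hyps[OF _ less.prems(1)] by meson
    from conjI[OF reach.step[OF S(1,4,3) Y(1)] Y(2)] show ?thesis by (rule exI)
  qed
qed

text \<open>A reachable \<open>T\<close> other than \<open>V\<close> passes first through some
  \<open>V \<union> S\<close>. By induction the continuations from there have total weight at most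
  2, and the first steps together weigh at most \<open>2 ^ d * \<gamma>\<close> by
  saturation.\<close>

lemma reach_weight:
  fixes q \<gamma> :: real
  assumes fN: "finite N" and q: "0 < q" and A: "\<And>S. S \<in> A \<Longrightarrow> S \<subseteq> N"
    and sat: "\<And>U. U \<subseteq> N \<Longrightarrow> U \<notin> A \<Longrightarrow> (\<Sum>S\<in>{S\<in>A. U \<subset> S}. q ^ card (S - U)) \<le> \<gamma>"
    and small: "2 ^ d * \<gamma> * 2 \<le> 1" and \<gamma>: "0 < \<gamma>" and V: "V \<subseteq> N"
  shows "(\<Sum>T\<in>{T. T \<subseteq> N \<and> card T \<le> d \<and> reach A V T \<and> T \<noteq> V}. q ^ card (T - V)) \<le> 2 * (2 ^ d * \<gamma>)"
  using V
proof (induction "card (N - V)" arbitrary: V rule: less_induct)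
  case less
  have fin: "finite U" if "U \<subseteq> N" for U using that fN finite_subset by blast
  have finPow: "finite {T. T \<subseteq> N \<and> P T}" for P using fN by simp
  have finA: "finite A" using A fN by (intro finite_subset[of A "Pow N"]) auto
  let ?R = "\<lambda>V. {T. T \<subseteq> N \<and> card T \<le> d \<and> reach A V T}"
  let ?P = "{T. T \<subseteq> N \<and> card T \<le> d \<and> reach A V T \<and> T \<noteq> V}"
  define St where "St = {S\<in>A. S \<inter> V \<notin> A \<and> \<not> S \<subseteq> V}"
  have finSt: "finite St" using finA by (simp add: St_def)
  show ?case
  proof (cases "card V \<le> d")
    case False
    have "?P = {}"
    proof (rule ccontr)
      assume "?P \<noteq> {}"
      then obtain T where "T \<subseteq> N" "card T \<le> d" "V \<subseteq> T" using reach_subset by blast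
      then show False using False card_mono[of T V] fin by auto
    qed
    then show ?thesis unfolding \<open>?P = {}\<close> using \<gamma> by simp
  next
    case True
    \<comment> \<open>The empty continuation contributes 1, the others at most 1 by the induction
      hypothesis and \<open>small\<close>.\<close>
    have R2: "(\<Sum>T\<in>?R (V \<union> S). q ^ card (T - (V \<union> S))) \<le> 2" if S: "S \<in> St" for S
    proof -
      have sub: "S \<subseteq> N" using S A by (auto simp: St_def)
      have "card (N - (V \<union> S)) < card (N - V)"
        using S sub fN by (intro psubset_card_mono) (auto simp: St_def)
      then have "(\<Sum>T\<in>{T. T \<subseteq> N \<and> card T \<le> d \<and> reach A (V \<union> S) T \<and> T \<noteq> V \<union> S}. q ^ card (T - (V \<union> S)))
        \<le> 2 * (2 ^ d * \<gamma>)" (is "sum _ ?Q \<le> _")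
        using less.hyps less.prems sub by auto
      moreover have "(\<Sum>T\<in>?R (V \<union> S). q ^ card (T - (V \<union> S))) \<le>
        (\<Sum>T\<in>insert (V \<union> S) ?Q. q ^ card (T - (V \<union> S)))"
        using q finPow by (intro sum_mono2) auto
      moreover have "\<dots> = 1 + (\<Sum>T\<in>?Q. q ^ card (T - (V \<union> S)))"
        using finPow by (subst sum.insert) auto
      ultimately show ?thesis using small by linarith
    qed
    have "(\<Sum>T\<in>?P. q ^ card (T - V)) \<le> (\<Sum>T\<in>?P. \<Sum>S\<in>St. of_bool (T \<in> ?R (V \<union> S)) * q ^ card (T - V))"
    proof (rule sum_mono)
      fix T assume T: "T \<in> ?P"
      then have "reach A V T" "T \<noteq> V" by auto
      then obtain S where S: "S \<in> St" "T \<in> ?R (V \<union> S)"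
        using T by (cases rule: reach.cases) (auto simp: St_def)
      have "q ^ card (T - V) = (\<Sum>S\<in>{S}. of_bool (T \<in> ?R (V \<union> S)) * q ^ card (T - V))"
        using S by simp
      also have "\<dots> \<le> (\<Sum>S\<in>St. of_bool (T \<in> ?R (V \<union> S)) * q ^ card (T - V))"
        using S q finSt by (intro sum_mono2) auto
      finally show "q ^ card (T - V) \<le> \<dots>" .
    qed
    also have "\<dots> = (\<Sum>S\<in>St. \<Sum>T\<in>?P. of_bool (T \<in> ?R (V \<union> S)) * q ^ card (T - V))"
      by (rule sum.swap)
    also have "\<dots> \<le> (\<Sum>S\<in>St. q ^ card (S - V) * 2)"
    proof (rule sum_mono)
      fix S assume S: "S \<in> St"
      have "(\<Sum>T\<in>?P. of_bool (T \<in> ?R (V \<union> S)) * q ^ card (T - V)) \<le>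
        (\<Sum>T\<in>?P \<inter> ?R (V \<union> S). q ^ card (T - V))"
        using finPow by (intro eq_refl) (auto simp: sum.inter_restrict intro!: sum.cong)
      also have "\<dots> \<le> (\<Sum>T\<in>?R (V \<union> S). q ^ card (T - V))"
        using finPow q by (intro sum_mono2) auto
      also have "\<dots> = (\<Sum>T\<in>?R (V \<union> S). q ^ card (S - V) * q ^ card (T - (V \<union> S)))"
      proof (rule sum.cong)
        fix T assume "T \<in> ?R (V \<union> S)"
        then have T: "V \<union> S \<subseteq> T" "finite T" using reach_subset fin by blast+
        then have "T - V = (S - V) \<union> (T - (V \<union> S))" by auto
        moreover have "card ((S - V) \<union> (T - (V \<union> S))) = card (S - V) + card (T - (V \<union> S))"
          using T finite_subset by (intro card_Un_disjoint) auto
        ultimately show "q ^ card (T - V) = q ^ card (S - V) * q ^ card (T - (V \<union> S))"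
          by (simp add: power_add)
      qed simp
      also have "\<dots> \<le> q ^ card (S - V) * 2"
        unfolding sum_distrib_left[symmetric] using R2[OF S] q by (intro mult_left_mono) auto
      finally show "(\<Sum>T\<in>?P. of_bool (T \<in> ?R (V \<union> S)) * q ^ card (T - V)) \<le> \<dots>" .
    qed
    also have "\<dots> \<le> 2 * (2 ^ d * \<gamma>)"
    proof -
      \<comment> \<open>The first steps are grouped by their trace \<open>U\<close> on
        \<open>V\<close>. There are at most \<open>2 ^ d\<close> inactive traces, and
        \<open>sat\<close> bounds the weight for each by \<open>\<gamma>\<close>.\<close>
      have "(\<Sum>S\<in>St. q ^ card (S - V)) \<le> (\<Sum>S\<in>St. \<Sum>U\<in>Pow V - A. of_bool (S \<inter> V = U) * q ^ card (S - U))"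
      proof (rule sum_mono)
        fix S assume S: "S \<in> St"
        have "q ^ card (S - V) = (\<Sum>U\<in>{S \<inter> V}. of_bool (S \<inter> V = U) * q ^ card (S - U))"
          by (simp add: Diff_Int)
        also have "\<dots> \<le> (\<Sum>U\<in>Pow V - A. of_bool (S \<inter> V = U) * q ^ card (S - U))"
          using S q fin[OF less.prems] by (intro sum_mono2) (auto simp: St_def)
        finally show "q ^ card (S - V) \<le> \<dots>" .
      qed
      also have "\<dots> = (\<Sum>U\<in>Pow V - A. \<Sum>S\<in>St. of_bool (S \<inter> V = U) * q ^ card (S - U))"
        by (rule sum.swap)
      also have "\<dots> \<le> (\<Sum>U\<in>Pow V - A. \<gamma>)"
      proof (rule sum_mono)
        fix U assume U: "U \<in> Pow V - A"
        have "(\<Sum>S\<in>St. of_bool (S \<inter> V = U) * q ^ card (S - U)) = (\<Sum>S\<in>{S\<in>St. S \<inter> V = U}. q ^ card (S - U))"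
          using finSt by (simp add: sum_of_bool_mult_eq Int_def)
        also have "\<dots> \<le> (\<Sum>S\<in>{S\<in>A. U \<subset> S}. q ^ card (S - U))"
          using finA q by (intro sum_mono2) (auto simp: St_def)
        also have "\<dots> \<le> \<gamma>" using U less.prems by (intro sat) auto
        finally show "(\<Sum>S\<in>St. of_bool (S \<inter> V = U) * q ^ card (S - U)) \<le> \<gamma>" .
      qed
      also have "\<dots> = real (card (Pow V - A)) * \<gamma>" by simp
      also have "\<dots> \<le> 2 ^ d * \<gamma>"
      proof (rule mult_right_mono)
        have "card (Pow V - A) \<le> card (Pow V)"
          using fin[OF less.prems] by (intro card_mono) auto
        also have "\<dots> \<le> 2 ^ d"
          using fin[OF less.prems] True by (simp add: card_Pow)
        finally show "real (card (Pow V - A)) \<le> 2 ^ d" by (simp flip: of_nat_le_iff)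
      qed (use \<gamma> in simp)
      finally show ?thesis by (simp flip: sum_distrib_right)
    qed
    finally show ?thesis .
  qed
qed

text \<open>Up to the factor \<open>q ^ card (T - V)\<close>, the coefficient of
  \<open>chr q V\<close> in the error made when \<open>chr q T\<close> is replaced by
  \<open>core_chr q A T\<close>.\<close>

definition defect :: "'a set set \<Rightarrow> 'a set \<Rightarrow> 'a set \<Rightarrow> real" where
  "defect A V T = (\<Sum>Z\<in>Pow T. of_bool (V \<subseteq> Z \<and> \<not> V \<subseteq> core A Z) * (-1) ^ card (T - Z))"

lemma abs_defect_le:
  assumes "finite T"
  shows "\<bar>defect A V T\<bar> \<le> 2 ^ card T"
proof -
  have "\<bar>defect A V T\<bar> \<le> (\<Sum>Z\<in>Pow T. 1)"
    unfolding defect_def by (rule order.trans[OF sum_abs], rule sum_mono) (simp add: abs_mult power_abs)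
  then show ?thesis using assms by (simp add: card_Pow)
qed

text \<open>This confines the error of \<open>chr q T\<close> to the pairs whose total weight
  \<open>reach_weight\<close> controls.\<close>

lemma reach_if_defect_nonzero:
  assumes fT: "finite T" and VT: "V \<subseteq> T" and T: "core A T = T" and nz: "defect A V T \<noteq> 0"
  shows "reach A V T \<and> T \<noteq> V"
proof
  show "T \<noteq> V"
  proof
    assume "T = V"
    then have "of_bool (V \<subseteq> Z \<and> \<not> V \<subseteq> core A Z) = (0::real)" if "Z \<in> Pow T" for Z
      using that T by auto
    then have "defect A V T = 0" unfolding defect_def by (intro sum.neutral) auto
    then show False using nz by simp
  qed
  obtain Y where Y: "reach A V Y" "Y \<subseteq> T" "\<And>S. S \<in> A \<Longrightarrow> S \<subseteq> T \<Longrightarrow> S \<subseteq> Y \<or> S \<inter> Y \<in> A"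
    using reach_closed[OF fT VT] by meson
  have VY: "V \<subseteq> Y" using Y(1) by (rule reach_subset)
  \<comment> \<open>An active \<open>S \<subseteq> Z\<close> through a point \<open>v\<close> of
    \<open>V\<close> may be replaced by \<open>S \<inter> Y\<close>, which is active, contains
    \<open>v\<close> and lies in \<open>Z \<inter> Y\<close>.\<close>
  have key: "V \<subseteq> core A Z \<longleftrightarrow> V \<subseteq> core A (Z \<inter> Y)" if "Z \<subseteq> T" for Z
  proof
    assume *: "V \<subseteq> core A Z"
    show "V \<subseteq> core A (Z \<inter> Y)"
    proof
      fix v assume v: "v \<in> V"
      then obtain S where "S \<in> A" "S \<subseteq> Z" "v \<in> S" using * by (auto simp: core_def)
      then show "v \<in> core A (Z \<inter> Y)" using Y(3)[of S] v VY that unfolding core_def by blast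
    qed
  qed (use core_mono[of "Z \<inter> Y" Z A] in auto)
  \<comment> \<open>Adding or removing a point outside the closure \<open>Y\<close> of \<open>V\<close> does not affect the conditions on \<open>Z\<close>,
    so the terms of the defect cancel in pairs.\<close>
  have "T \<subseteq> Y"
  proof (rule ccontr)
    assume "\<not> T \<subseteq> Y"
    then obtain i where i: "i \<in> T" "i \<notin> Y" by auto
    define W where "W = T - {i}"
    have W: "T = insert i W" "finite W" "i \<notin> W" using i fT by (auto simp: W_def)
    have "defect A V T = 0"
      unfolding defect_def W(1) sum_Pow_insert[OF W(2,3)]
    proof (rule sum.neutral, rule ballI)
      fix Z assume Z: "Z \<in> Pow W"
      have "insert i Z \<inter> Y = Z \<inter> Y" using i by auto
      then have "V \<subseteq> core A (insert i Z) \<longleftrightarrow> V \<subseteq> core A Z"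
        using key[of "insert i Z"] key[of Z] Z W by auto
      moreover have "V \<subseteq> insert i Z \<longleftrightarrow> V \<subseteq> Z" using i VY by auto
      moreover have "insert i W - Z = insert i (W - Z)" "insert i W - insert i Z = W - Z" "i \<notin> W - Z"
        using Z W by auto
      moreover have "finite (W - Z)" using W by auto
      ultimately show "of_bool (V \<subseteq> Z \<and> \<not> V \<subseteq> core A Z) * (- 1) ^ card (insert i W - Z) +
         of_bool (V \<subseteq> insert i Z \<and> \<not> V \<subseteq> core A (insert i Z)) * (- 1) ^ card (insert i W - insert i Z) = (0::real)"
        by simp
    qed
    then show False using nz by simp
  qed
  then show "reach A V T" using Y by auto
qed

subsection \<open>Measurable approximation of the characters\<close>

lemma chr_eq_sum_indicators:
  assumes "finite T"
  shows "chr q T X = (\<Sum>Z\<in>Pow T. (- q) ^ card (T - Z) * of_bool (Z \<subseteq> X))"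
proof -
  have "(\<Prod>i\<in>Z. of_bool (i \<in> X)) = (of_bool (Z \<subseteq> X) :: real)" if "Z \<subseteq> T" for Z
    using finite_subset[OF that assms] by (induction Z rule: finite_induct) auto
  then show ?thesis
    using prod_add[OF assms, of "\<lambda>i. of_bool (i \<in> X)" "\<lambda>_. - q"]
    by (simp add: chr_def mult_ac)
qed

text \<open>Each factor is written as \<open>(of_bool (i \<in> X) - q) + q\<close> and the product
  is expanded.\<close>

lemma indicator_eq_sum_chr:
  assumes "finite Z"
  shows "of_bool (Z \<subseteq> X) = (\<Sum>V\<in>Pow Z. q ^ card (Z - V) * chr q V X)"
proof -
  have "(\<Prod>i\<in>Z. of_bool (i \<in> X)) = (of_bool (Z \<subseteq> X) :: real)"
    using assms by (induction Z rule: finite_induct) auto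
  then show ?thesis
    using prod_add[OF assms, of "\<lambda>i. of_bool (i \<in> X) - q" "\<lambda>_. q"]
    by (simp add: chr_def mult_ac)
qed

text \<open>The expansion of \<open>chr q T\<close> into indicators of
  \<open>Z \<subseteq> X\<close>, with each indicator replaced. The factor
  \<open>q ^ card (Z - core A Z)\<close> is the probability of \<open>Z \<subseteq> X\<close> given
  \<open>core A Z \<subseteq> X\<close>.\<close>

definition core_chr :: "real \<Rightarrow> 'a set set \<Rightarrow> 'a set \<Rightarrow> 'a set \<Rightarrow> real" where
  "core_chr q A T X = (\<Sum>Z\<in>Pow T. (- q) ^ card (T - Z) *
     (q ^ card (Z - core A Z) * of_bool (core A Z \<subseteq> X)))"

lemma core_chr_core: "core_chr q A T (core A X) = core_chr q A T X"
  by (simp add: core_chr_def core_subset_core_iff)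

text \<open>After expansion in characters the replacement for the indicator of
  \<open>Z \<subseteq> X\<close> agrees with it on all \<open>V \<subseteq> core A Z\<close>; only
  the other \<open>V \<subseteq> Z\<close> remain. For these the exponents of \<open>q\<close> from
  \<open>T - Z\<close> and \<open>Z - V\<close> add up to \<open>card (T - V)\<close>, independently
  of \<open>Z\<close>.\<close>

lemma chr_minus_core_chr:
  assumes fT: "finite T"
  shows "chr q T X - core_chr q A T X = (\<Sum>V\<in>Pow T. q ^ card (T - V) * defect A V T * chr q V X)"
proof -
  have ind: "of_bool (Z \<subseteq> X) - q ^ card (Z - core A Z) * of_bool (core A Z \<subseteq> X) =
    (\<Sum>V\<in>Pow T. of_bool (V \<subseteq> Z \<and> \<not> V \<subseteq> core A Z) * (q ^ card (Z - V) * chr q V X))"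
    if Z: "Z \<in> Pow T" for Z
  proof -
    have fZ: "finite Z" "finite (core A Z)"
      using Z fT finite_subset core_subset[of A Z] by (blast, metis PowD finite_subset)
    have "q ^ card (Z - core A Z) * of_bool (core A Z \<subseteq> X) =
      (\<Sum>V\<in>Pow (core A Z). q ^ card (Z - core A Z) * (q ^ card (core A Z - V) * chr q V X))"
      unfolding indicator_eq_sum_chr[OF fZ(2), of X q] sum_distrib_left ..
    also have "\<dots> = (\<Sum>V\<in>Pow (core A Z). q ^ card (Z - V) * chr q V X)"
    proof (rule sum.cong)
      fix V assume "V \<in> Pow (core A Z)"
      then have "Z - V = (Z - core A Z) \<union> (core A Z - V)" using core_subset[of A Z] by auto
      moreover have "card ((Z - core A Z) \<union> (core A Z - V)) = card (Z - core A Z) + card (core A Z - V)"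
        using fZ by (intro card_Un_disjoint) auto
      ultimately show "q ^ card (Z - core A Z) * (q ^ card (core A Z - V) * chr q V X) =
        q ^ card (Z - V) * chr q V X"
        by (simp add: power_add)
    qed simp
    finally have "of_bool (Z \<subseteq> X) - q ^ card (Z - core A Z) * of_bool (core A Z \<subseteq> X) =
      (\<Sum>V\<in>Pow Z. q ^ card (Z - V) * chr q V X) - (\<Sum>V\<in>Pow (core A Z). q ^ card (Z - V) * chr q V X)"
      using indicator_eq_sum_chr[OF fZ(1), of X q] by simp
    also have "\<dots> = (\<Sum>V\<in>Pow Z - Pow (core A Z). q ^ card (Z - V) * chr q V X)"
      using fZ core_subset[of A Z] by (subst sum_diff) auto
    also have "Pow Z - Pow (core A Z) = Pow T \<inter> {V. V \<subseteq> Z \<and> \<not> V \<subseteq> core A Z}"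
      using Z by auto
    finally show ?thesis using fT by simp
  qed
  have "chr q T X - core_chr q A T X =
    (\<Sum>Z\<in>Pow T. (- q) ^ card (T - Z) *
      (of_bool (Z \<subseteq> X) - q ^ card (Z - core A Z) * of_bool (core A Z \<subseteq> X)))"
    by (simp only: chr_eq_sum_indicators[OF fT] core_chr_def sum_subtractf right_diff_distrib)
  also have "\<dots> = (\<Sum>Z\<in>Pow T. \<Sum>V\<in>Pow T. (- q) ^ card (T - Z) *
      (of_bool (V \<subseteq> Z \<and> \<not> V \<subseteq> core A Z) * (q ^ card (Z - V) * chr q V X)))"
    by (simp only: sum_distrib_left[symmetric] ind cong: sum.cong)
  also have "\<dots> = (\<Sum>V\<in>Pow T. \<Sum>Z\<in>Pow T. (- q) ^ card (T - Z) *
      (of_bool (V \<subseteq> Z \<and> \<not> V \<subseteq> core A Z) * (q ^ card (Z - V) * chr q V X)))"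
    by (rule sum.swap)
  also have "\<dots> = (\<Sum>V\<in>Pow T. q ^ card (T - V) * defect A V T * chr q V X)"
  proof (rule sum.cong)
    fix V assume V: "V \<in> Pow T"
    have "(- q) ^ card (T - Z) * (of_bool (V \<subseteq> Z \<and> \<not> V \<subseteq> core A Z) * (q ^ card (Z - V) * chr q V X))
      = q ^ card (T - V) * chr q V X * (of_bool (V \<subseteq> Z \<and> \<not> V \<subseteq> core A Z) * (- 1) ^ card (T - Z))"
      if Z: "Z \<in> Pow T" for Z
    proof (cases "V \<subseteq> Z")
      case True
      have "finite Z" using Z fT finite_subset by auto
      have "T - V = (T - Z) \<union> (Z - V)" using True Z by auto
      moreover have "card ((T - Z) \<union> (Z - V)) = card (T - Z) + card (Z - V)"
        using fT \<open>finite Z\<close> by (intro card_Un_disjoint) auto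
      ultimately show ?thesis by (simp add: power_add power_minus[of q])
    qed simp
    then show "(\<Sum>Z\<in>Pow T. (- q) ^ card (T - Z) *
      (of_bool (V \<subseteq> Z \<and> \<not> V \<subseteq> core A Z) * (q ^ card (Z - V) * chr q V X))) =
      q ^ card (T - V) * defect A V T * chr q V X"
      by (simp only: defect_def sum_distrib_left[symmetric] mult_ac cong: sum.cong)
  qed simp
  finally show ?thesis .
qed

text \<open>Parseval reduces the claim to the error coefficients \<open>e V\<close>. Cauchy-Schwarz
  with weights \<open>q ^ card (T - V)\<close> gives one factor bounded by
  \<open>reach_weight\<close>, which supplies \<open>\<gamma>\<close>, and one bounded by the
  weights of the \<open>T\<close> in \<open>C\<close>. The constant collects
  \<open>2 * 2 ^ d\<close> from \<open>reach_weight\<close>, \<open>4 ^ d\<close> from the squared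
  defects, \<open>2 ^ d\<close> from passing from \<open>q\<close> to \<open>s\<close>, and
  \<open>2 ^ d\<close> from the number of \<open>V \<subseteq> T\<close>.\<close>

lemma core_chr_error:
  fixes q \<gamma> :: real and N :: "'a set"
  assumes fN: "finite N" and q: "0 < q" "q \<le> 1 / 2" and A: "\<And>S. S \<in> A \<Longrightarrow> S \<subseteq> N"
    and sat: "\<And>U. U \<subseteq> N \<Longrightarrow> U \<notin> A \<Longrightarrow> (\<Sum>S\<in>{S\<in>A. U \<subset> S}. q ^ card (S - U)) \<le> \<gamma>"
    and small: "2 ^ d * \<gamma> * 2 \<le> 1" and \<gamma>: "0 < \<gamma>"
    and C: "\<And>T. T \<in> C \<Longrightarrow> T \<subseteq> N \<and> card T \<le> d \<and> core A T = T"
  shows "bmean q N (\<lambda>X. (\<Sum>T\<in>C. \<alpha> T * (chr q T X - core_chr q A T X))\<^sup>2)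
    \<le> 2 ^ (5 * d + 1) * \<gamma> * (\<Sum>T\<in>C. (q * (1 - q)) ^ card T * (\<alpha> T)\<^sup>2)"
proof -
  define s where "s = q * (1 - q)"
  have s: "0 < s" using q by (simp add: s_def)
  have fin: "finite U" if "U \<subseteq> N" for U using that fN finite_subset by blast
  have finC: "finite C" using C fN by (intro finite_subset[of C "Pow N"]) auto
  define e where "e V = (\<Sum>T\<in>C. of_bool (V \<subseteq> T) * (\<alpha> T * q ^ card (T - V) * defect A V T))" for V
  have "(\<Sum>T\<in>C. \<alpha> T * (chr q T X - core_chr q A T X)) = expansion q N e X" for X
  proof -
    have "(\<Sum>T\<in>C. \<alpha> T * (chr q T X - core_chr q A T X)) =
      (\<Sum>T\<in>C. \<Sum>V\<in>Pow N. of_bool (V \<subseteq> T) * (\<alpha> T * q ^ card (T - V) * defect A V T) * chr q V X)"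
    proof (rule sum.cong)
      fix T assume T: "T \<in> C"
      have "\<alpha> T * (chr q T X - core_chr q A T X) =
        (\<Sum>V\<in>Pow T. \<alpha> T * q ^ card (T - V) * defect A V T * chr q V X)"
        using C[OF T] fin by (subst chr_minus_core_chr) (auto simp: sum_distrib_left mult.assoc)
      also have "Pow T = Pow N \<inter> {V. V \<subseteq> T}" using C[OF T] by auto
      finally show "\<alpha> T * (chr q T X - core_chr q A T X) =
        (\<Sum>V\<in>Pow N. of_bool (V \<subseteq> T) * (\<alpha> T * q ^ card (T - V) * defect A V T) * chr q V X)"
        using fN by (simp add: mult.assoc)
    qed simp
    also have "\<dots> = (\<Sum>V\<in>Pow N. e V * chr q V X)"
      unfolding e_def sum_distrib_right by (rule sum.swap)
    finally show ?thesis by (simp add: expansion_def)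
  qed
  then have "bmean q N (\<lambda>X. (\<Sum>T\<in>C. \<alpha> T * (chr q T X - core_chr q A T X))\<^sup>2) =
    (\<Sum>V\<in>Pow N. s ^ card V * (e V)\<^sup>2)"
    using Parseval[OF fN, of q e e] by (simp add: power2_eq_square s_def)
  also have "\<dots> \<le> (\<Sum>V\<in>Pow N. \<Sum>T\<in>C. of_bool (V \<subseteq> T) * (2 ^ (4 * d + 1) * \<gamma> * (s ^ card T * (\<alpha> T)\<^sup>2)))"
  proof (rule sum_mono)
    fix V assume "V \<in> Pow N"
    then have V: "V \<subseteq> N" by simp
    define R where "R = {T\<in>C. V \<subseteq> T \<and> defect A V T \<noteq> 0}"
    have finR: "finite R" using finC by (simp add: R_def)
    \<comment> \<open>The power of \<open>q\<close> is split evenly between the two factors for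
      Cauchy-Schwarz.\<close>
    have "e V = (\<Sum>T\<in>R. (sqrt q ^ card (T - V)) * (sqrt q ^ card (T - V) * (defect A V T * \<alpha> T)))"
    proof -
      have "e V = (\<Sum>T\<in>R. \<alpha> T * q ^ card (T - V) * defect A V T)"
        unfolding e_def R_def using finC by (intro sum.mono_neutral_cong_right) auto
      also have "\<dots> = (\<Sum>T\<in>R. (sqrt q * sqrt q) ^ card (T - V) * (defect A V T * \<alpha> T))"
        using q by (simp add: mult_ac)
      finally show ?thesis by (simp only: power_mult_distrib mult.assoc)
    qed
    then have "(e V)\<^sup>2 \<le> (\<Sum>T\<in>R. (sqrt q ^ card (T - V))\<^sup>2) *
      (\<Sum>T\<in>R. (sqrt q ^ card (T - V) * (defect A V T * \<alpha> T))\<^sup>2)"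
      using Cauchy_Schwarz_ineq_sum by metis
    also have "\<dots> = (\<Sum>T\<in>R. q ^ card (T - V)) * (\<Sum>T\<in>R. q ^ card (T - V) * (defect A V T * \<alpha> T)\<^sup>2)"
    proof -
      have "(sqrt q ^ m)\<^sup>2 = q ^ m" for m
        using q by (simp add: power2_eq_square flip: power_mult_distrib)
      then show ?thesis by (simp only: power_mult_distrib[of "sqrt q ^ _"])
    qed
    also have "\<dots> \<le> (2 * (2 ^ d * \<gamma>)) * (\<Sum>T\<in>R. q ^ card (T - V) * (4 ^ d * (\<alpha> T)\<^sup>2))"
    proof (rule mult_mono)
      have "R \<subseteq> {T. T \<subseteq> N \<and> card T \<le> d \<and> reach A V T \<and> T \<noteq> V}"
      proof
        fix T assume "T \<in> R"
        then have T: "T \<in> C" "V \<subseteq> T" "defect A V T \<noteq> 0" by (auto simp: R_def)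
        have "finite T" "core A T = T" using C[OF T(1)] fin[of T] by simp_all
        from reach_if_defect_nonzero[OF this(1) T(2) this(2) T(3)]
        show "T \<in> {T. T \<subseteq> N \<and> card T \<le> d \<and> reach A V T \<and> T \<noteq> V}"
          using C[OF T(1)] by simp
      qed
      then have "(\<Sum>T\<in>R. q ^ card (T - V)) \<le>
        (\<Sum>T\<in>{T. T \<subseteq> N \<and> card T \<le> d \<and> reach A V T \<and> T \<noteq> V}. q ^ card (T - V))"
        using fN q by (intro sum_mono2) auto
      also have "\<dots> \<le> 2 * (2 ^ d * \<gamma>)"
        using fN q(1) A sat small \<gamma> V by (rule reach_weight)
      finally show "(\<Sum>T\<in>R. q ^ card (T - V)) \<le> 2 * (2 ^ d * \<gamma>)" .
      show "(\<Sum>T\<in>R. q ^ card (T - V) * (defect A V T * \<alpha> T)\<^sup>2) \<le>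
        (\<Sum>T\<in>R. q ^ card (T - V) * (4 ^ d * (\<alpha> T)\<^sup>2))"
      proof (intro sum_mono mult_left_mono)
        fix T assume "T \<in> R"
        then have T: "T \<in> C" by (simp add: R_def)
        have "\<bar>defect A V T\<bar> \<le> 2 ^ card T"
          using C[OF T] fin by (intro abs_defect_le) auto
        also have "\<dots> \<le> 2 ^ d"
          using C[OF T] by (intro power_increasing) auto
        finally have "\<bar>defect A V T\<bar> \<le> 2 ^ d" .
        then have "(defect A V T)\<^sup>2 \<le> (2 ^ d)\<^sup>2"
          using power_mono[of "\<bar>defect A V T\<bar>" "2 ^ d" 2] by simp
        also have "\<dots> = 4 ^ d" by (simp add: power2_eq_square flip: power_mult_distrib)
        finally show "(defect A V T * \<alpha> T)\<^sup>2 \<le> 4 ^ d * (\<alpha> T)\<^sup>2"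
          unfolding power_mult_distrib by (intro mult_right_mono) auto
      qed (use q in auto)
    qed (use q \<gamma> in \<open>auto intro!: sum_nonneg mult_nonneg_nonneg\<close>)
    finally have "s ^ card V * (e V)\<^sup>2 \<le>
      s ^ card V * ((2 * (2 ^ d * \<gamma>)) * (\<Sum>T\<in>R. q ^ card (T - V) * (4 ^ d * (\<alpha> T)\<^sup>2)))"
      using s by (intro mult_left_mono) auto
    also have "\<dots> = (\<Sum>T\<in>R. 2 ^ (3 * d + 1) * \<gamma> * (\<alpha> T)\<^sup>2 * (s ^ card V * q ^ card (T - V)))"
    proof -
      have "(2::real) ^ (3 * d + 1) = 2 * (2 ^ d * 4 ^ d)"
      proof -
        have "(4::real) ^ d = (2 ^ d)\<^sup>2" by (simp add: power2_eq_square flip: power_mult_distrib)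
        then show ?thesis by (simp add: power_add power_mult power2_eq_square power3_eq_cube flip: power_mult_distrib)
      qed
      then show ?thesis by (simp add: sum_distrib_left mult_ac)
    qed
    also have "\<dots> \<le> (\<Sum>T\<in>R. 2 ^ (3 * d + 1) * \<gamma> * (\<alpha> T)\<^sup>2 * (2 ^ d * s ^ card T))"
    proof (intro sum_mono mult_left_mono)
      fix T assume "T \<in> R"
      then have T: "T \<in> C" "V \<subseteq> T" by (auto simp: R_def)
      have fT: "finite T" using C[OF T(1)] fin by auto
      have cT: "card T = card V + card (T - V)"
        using T(2) fT card_Diff_subset[of V T] finite_subset[of V T] card_mono[of T V] by auto
      \<comment> \<open>Here \<open>q \<le> 1 / 2\<close> enters: powers of \<open>q\<close> and of
        \<open>s\<close> with exponent at most \<open>d\<close> differ by at most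
        \<open>2 ^ d\<close>.\<close>
      have "q \<le> 2 * s"
        using q mult_left_mono[of "1/2" "1 - q" q] by (simp add: s_def)
      then have "q ^ card (T - V) \<le> (2 * s) ^ card (T - V)"
        using q by (intro power_mono) auto
      also have "\<dots> \<le> 2 ^ d * s ^ card (T - V)"
        unfolding power_mult_distrib using s C[OF T(1)] cT
        by (intro mult_right_mono power_increasing) auto
      finally have "s ^ card V * q ^ card (T - V) \<le> s ^ card V * (2 ^ d * s ^ card (T - V))"
        using s by (intro mult_left_mono) auto
      then show "s ^ card V * q ^ card (T - V) \<le> 2 ^ d * s ^ card T"
        unfolding cT by (simp add: power_add mult_ac)
    qed (use \<gamma> in auto)
    also have "\<dots> = (\<Sum>T\<in>R. 2 ^ (4 * d + 1) * \<gamma> * (s ^ card T * (\<alpha> T)\<^sup>2))"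
    proof -
      have "(2::real) ^ (4 * d + 1) = 2 ^ (3 * d + 1) * 2 ^ d" by (simp flip: power_add)
      then show ?thesis by (simp add: mult_ac)
    qed
    also have "\<dots> \<le> (\<Sum>T\<in>C \<inter> {T. V \<subseteq> T}. 2 ^ (4 * d + 1) * \<gamma> * (s ^ card T * (\<alpha> T)\<^sup>2))"
      using finC s \<gamma> by (intro sum_mono2) (auto simp: R_def)
    finally show "s ^ card V * (e V)\<^sup>2 \<le>
      (\<Sum>T\<in>C. of_bool (V \<subseteq> T) * (2 ^ (4 * d + 1) * \<gamma> * (s ^ card T * (\<alpha> T)\<^sup>2)))"
      using finC by simp
  qed
  also have "\<dots> = (\<Sum>T\<in>C. real (card (Pow T)) * (2 ^ (4 * d + 1) * \<gamma> * (s ^ card T * (\<alpha> T)\<^sup>2)))"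
  proof (subst sum.swap, rule sum.cong)
    fix T assume T: "T \<in> C"
    have "Pow N \<inter> {V. V \<subseteq> T} = Pow T" using C[OF T] by auto
    then show "(\<Sum>V\<in>Pow N. of_bool (V \<subseteq> T) * (2 ^ (4 * d + 1) * \<gamma> * (s ^ card T * (\<alpha> T)\<^sup>2))) =
      real (card (Pow T)) * (2 ^ (4 * d + 1) * \<gamma> * (s ^ card T * (\<alpha> T)\<^sup>2))"
      using fN by simp
  qed simp
  also have "\<dots> \<le> (\<Sum>T\<in>C. 2 ^ d * (2 ^ (4 * d + 1) * \<gamma> * (s ^ card T * (\<alpha> T)\<^sup>2)))"
  proof (intro sum_mono mult_right_mono)
    fix T assume T: "T \<in> C"
    show "real (card (Pow T)) \<le> 2 ^ d"
      using C[OF T] fin by (simp add: card_Pow)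
  qed (use s \<gamma> in auto)
  also have "\<dots> = 2 ^ (5 * d + 1) * \<gamma> * (\<Sum>T\<in>C. s ^ card T * (\<alpha> T)\<^sup>2)"
  proof -
    have "(2::real) ^ (5 * d + 1) = 2 ^ d * 2 ^ (4 * d + 1)" by (simp flip: power_add)
    then show ?thesis by (simp add: sum_distrib_left mult_ac)
  qed
  finally show ?thesis by (simp add: s_def)
qed

subsection \<open>Influences\<close>

text \<open>For \<open>\<phi>\<close> with values in \<open>{0, 1}\<close>, the probability that
  resampling coordinate \<open>j\<close> changes the value at \<open>X\<close>; its mean is the
  influence of \<open>j\<close>.\<close>

definition local_var :: "real \<Rightarrow> ('a set \<Rightarrow> real) \<Rightarrow> 'a \<Rightarrow> 'a set \<Rightarrow> real" where
  "local_var q \<phi> j X = q * \<bar>\<phi> X - \<phi> (insert j X)\<bar> + (1 - q) * \<bar>\<phi> X - \<phi> (X - {j})\<bar>"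

lemma chr_resample:
  assumes "finite T"
  shows "q * chr q T (insert j X) + (1 - q) * chr q T (X - {j}) = of_bool (j \<notin> T) * chr q T X"
proof (cases "j \<in> T")
  case True
  define W where "W = T - {j}"
  have W: "T = insert j W" "finite W" "j \<notin> W" using True assms by (auto simp: W_def)
  show ?thesis
    unfolding W(1) chr_insert[OF W(2,3)] chr_insert_point[OF W(3)] chr_remove_point[OF W(3)]
    by (simp add: algebra_simps)
next
  case False
  then show ?thesis by (simp add: chr_insert_point chr_remove_point algebra_simps)
qed

lemma expansion_resample:
  assumes "finite N"
  shows "q * expansion q N \<alpha> (insert j X) + (1 - q) * expansion q N \<alpha> (X - {j}) =
    expansion q N (\<lambda>T. of_bool (j \<notin> T) * \<alpha> T) X"
proof -
  have "q * expansion q N \<alpha> (insert j X) + (1 - q) * expansion q N \<alpha> (X - {j}) =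
    (\<Sum>T\<in>Pow N. \<alpha> T * (q * chr q T (insert j X) + (1 - q) * chr q T (X - {j})))"
    unfolding expansion_def sum_distrib_left sum.distrib[symmetric]
    by (intro sum.cong) (simp_all add: algebra_simps)
  also have "\<dots> = (\<Sum>T\<in>Pow N. \<alpha> T * (of_bool (j \<notin> T) * chr q T X))"
  proof (rule sum.cong)
    fix T assume "T \<in> Pow N"
    then have "finite T" using assms finite_subset by auto
    then show "\<alpha> T * (q * chr q T (insert j X) + (1 - q) * chr q T (X - {j})) =
      \<alpha> T * (of_bool (j \<notin> T) * chr q T X)"
      by (simp only: chr_resample)
  qed simp
  finally show ?thesis by (simp add: expansion_def mult_ac)
qed

text \<open>Let \<open>F\<close> average out coordinate \<open>j\<close> and let \<open>H\<close> be
  the part of the expansion on \<open>\<T>\<close>. Then \<open>\<phi> - F\<close> is dominated by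
  \<open>D\<close>, which lies between 0 and 1 and has mean \<open>I\<close>, and
  \<open>\<beta>\<close> is the mean of \<open>(\<phi> - F) * H\<close>. Cauchy-Schwarz gives
  \<open>\<beta>\<^sup>2\<close> at most \<open>I\<close> times the mean of
  \<open>D * H\<^sup>2\<close>; bounding \<open>D\<close> by 1 yields the first claim, a second
  Cauchy-Schwarz the other.\<close>

lemma derivative_weight_le:
  fixes q :: real and N :: "'a set"
  assumes fN: "finite N" and q: "0 < q" "q < 1"
    and \<phi>: "\<And>X. X \<subseteq> N \<Longrightarrow> \<phi> X = expansion q N \<alpha> X" "\<And>X. X \<subseteq> N \<Longrightarrow> \<phi> X \<in> {0, 1}"
    and j: "j \<in> N" and T: "\<And>T. T \<in> \<T> \<Longrightarrow> j \<in> T"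
  defines "\<beta> \<equiv> (\<Sum>T\<in>Pow N. (q * (1 - q)) ^ card T * (of_bool (T \<in> \<T>) * (\<alpha> T)\<^sup>2))"
    and "I \<equiv> bmean q N (local_var q \<phi> j)"
  shows "\<beta> \<le> I"
    and "\<beta> ^ 4 \<le> I ^ 3 * bmean q N (\<lambda>X. expansion q N (\<lambda>T. of_bool (T \<in> \<T>) * \<alpha> T) X ^ 4)"
proof -
  define D where "D = local_var q \<phi> j"
  define H where "H = expansion q N (\<lambda>T. of_bool (T \<in> \<T>) * \<alpha> T)"
  define F where "F = expansion q N (\<lambda>T. of_bool (j \<notin> T) * \<alpha> T)"
  have D: "0 \<le> D X" "D X \<le> 1" if "X \<subseteq> N" for X
  proof -
    have "\<bar>\<phi> X - \<phi> (insert j X)\<bar> \<le> 1" "\<bar>\<phi> X - \<phi> (X - {j})\<bar> \<le> 1"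
      using \<phi>(2)[OF that] \<phi>(2)[of "insert j X"] \<phi>(2)[of "X - {j}"] that j by force+
    then have "q * \<bar>\<phi> X - \<phi> (insert j X)\<bar> \<le> q * 1" "(1 - q) * \<bar>\<phi> X - \<phi> (X - {j})\<bar> \<le> (1 - q) * 1"
      using q by (auto intro!: mult_left_mono)
    then show "D X \<le> 1" by (simp add: D_def local_var_def)
    show "0 \<le> D X" using q by (simp add: D_def local_var_def)
  qed
  have I: "I = bmean q N D" "0 \<le> I"
    unfolding I_def D_def[symmetric] using D q by (auto intro!: bmean_nonneg)
  have \<beta>H: "\<beta> = bmean q N (\<lambda>X. (H X)\<^sup>2)"
    unfolding H_def power2_eq_square Parseval[OF fN] \<beta>_def by (rule sum.cong) auto
  have \<beta>0: "0 \<le> \<beta>" unfolding \<beta>H using q by (intro bmean_nonneg) auto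
  have diff: "\<bar>\<phi> X - F X\<bar> \<le> D X" if X: "X \<subseteq> N" for X
  proof -
    have "F X = q * \<phi> (insert j X) + (1 - q) * \<phi> (X - {j})"
      unfolding F_def using expansion_resample[OF fN, of q \<alpha> j X] X j
        \<phi>(1)[of "insert j X"] \<phi>(1)[of "X - {j}"] by (simp add: subset_iff)
    then have "\<phi> X - F X = q * (\<phi> X - \<phi> (insert j X)) + (1 - q) * (\<phi> X - \<phi> (X - {j}))"
      by (simp add: algebra_simps)
    also have "\<bar>\<dots>\<bar> \<le> \<bar>q * (\<phi> X - \<phi> (insert j X))\<bar> + \<bar>(1 - q) * (\<phi> X - \<phi> (X - {j}))\<bar>"
      by (rule abs_triangle_ineq)
    finally show ?thesis using q by (simp add: D_def local_var_def abs_mult)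
  qed
  \<comment> \<open>\<open>F\<close> is supported on sets avoiding \<open>j\<close>,
    \<open>H\<close> on sets containing \<open>j\<close>.\<close>
  have "bmean q N (\<lambda>X. F X * H X) = 0"
    unfolding F_def H_def Parseval[OF fN] using T by (intro sum.neutral) auto
  moreover have "bmean q N (\<lambda>X. \<phi> X * H X) = \<beta>"
  proof -
    have "bmean q N (\<lambda>X. \<phi> X * H X) = bmean q N (\<lambda>X. expansion q N \<alpha> X * H X)"
      using \<phi>(1) by (intro bmean_cong) auto
    also have "\<dots> = \<beta>"
      unfolding H_def Parseval[OF fN] \<beta>_def by (rule sum.cong) (auto simp: power2_eq_square)
    finally show ?thesis .
  qed
  ultimately have "\<beta> = bmean q N (\<lambda>X. (\<phi> X - F X) * H X)"
    by (simp add: left_diff_distrib bmean_diff)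
  also have "\<dots> \<le> bmean q N (\<lambda>X. sqrt (D X) * (sqrt (D X) * \<bar>H X\<bar>))"
  proof (rule bmean_mono)
    fix X assume X: "X \<subseteq> N"
    have "(\<phi> X - F X) * H X \<le> \<bar>\<phi> X - F X\<bar> * \<bar>H X\<bar>" by (metis abs_ge_self abs_mult)
    also have "\<dots> \<le> D X * \<bar>H X\<bar>" using diff[OF X] by (intro mult_right_mono) auto
    finally show "(\<phi> X - F X) * H X \<le> sqrt (D X) * (sqrt (D X) * \<bar>H X\<bar>)"
      using D[OF X] by (simp flip: mult.assoc)
  qed (use q in auto)
  finally have "\<beta>\<^sup>2 \<le> (bmean q N (\<lambda>X. sqrt (D X) * (sqrt (D X) * \<bar>H X\<bar>)))\<^sup>2"
    using \<beta>0 by (intro power_mono) auto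
  also have "\<dots> \<le> bmean q N (\<lambda>X. (sqrt (D X))\<^sup>2) * bmean q N (\<lambda>X. (sqrt (D X) * \<bar>H X\<bar>)\<^sup>2)"
    using q by (intro bmean_Cauchy_Schwarz) auto
  also have "bmean q N (\<lambda>X. (sqrt (D X))\<^sup>2) = I"
    unfolding I using D by (intro bmean_cong) auto
  also have "bmean q N (\<lambda>X. (sqrt (D X) * \<bar>H X\<bar>)\<^sup>2) = bmean q N (\<lambda>X. D X * (H X)\<^sup>2)"
    using D by (intro bmean_cong) (auto simp: power_mult_distrib)
  finally have \<beta>2: "\<beta>\<^sup>2 \<le> I * bmean q N (\<lambda>X. D X * (H X)\<^sup>2)" .
  have "bmean q N (\<lambda>X. D X * (H X)\<^sup>2) \<le> \<beta>"
    unfolding \<beta>H using D q by (intro bmean_mono) (auto intro: mult_left_le_one_le)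
  then have "\<beta>\<^sup>2 \<le> I * \<beta>" using \<beta>2 I(2) by (meson mult_left_mono order.trans)
  then show "\<beta> \<le> I"
    using \<beta>0 I(2) by (cases "\<beta> = 0") (auto simp: power2_eq_square)
  \<comment> \<open>As \<open>D\<close> lies between 0 and 1, its second moment is at most its mean
    \<open>I\<close>.\<close>
  have "(bmean q N (\<lambda>X. D X * (H X)\<^sup>2))\<^sup>2 \<le> bmean q N (\<lambda>X. (D X)\<^sup>2) * bmean q N (\<lambda>X. ((H X)\<^sup>2)\<^sup>2)"
    using q by (intro bmean_Cauchy_Schwarz) auto
  also have "\<dots> \<le> I * bmean q N (\<lambda>X. H X ^ 4)"
  proof (rule mult_mono)
    show "bmean q N (\<lambda>X. (D X)\<^sup>2) \<le> I"
      unfolding I(1) using D q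
      by (intro bmean_mono) (auto simp: power2_eq_square intro: mult_left_le_one_le)
  qed (use q I in \<open>auto intro!: bmean_nonneg simp flip: power_mult\<close>)
  finally have "I\<^sup>2 * (bmean q N (\<lambda>X. D X * (H X)\<^sup>2))\<^sup>2 \<le> I\<^sup>2 * (I * bmean q N (\<lambda>X. H X ^ 4))"
    by (intro mult_left_mono) auto
  moreover have "(\<beta>\<^sup>2)\<^sup>2 \<le> (I * bmean q N (\<lambda>X. D X * (H X)\<^sup>2))\<^sup>2"
    using \<beta>2 by (intro power_mono) auto
  ultimately have "(\<beta>\<^sup>2)\<^sup>2 \<le> I\<^sup>2 * (I * bmean q N (\<lambda>X. H X ^ 4))"
    by (simp add: power_mult_distrib)
  then show "\<beta> ^ 4 \<le> I ^ 3 * bmean q N (\<lambda>X. expansion q N (\<lambda>T. of_bool (T \<in> \<T>) * \<alpha> T) X ^ 4)"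
    by (simp add: H_def power3_eq_cube power2_eq_square power4_eq_xxxx mult.assoc)
qed

text \<open>In the bound of \<open>global_hypercontractivity\<close> one of the two weights above
  \<open>S\<close> is at most \<open>4 ^ d * \<delta> * s ^ card S\<close>; the other is summed over
  \<open>S\<close>, where each \<open>T\<close> is counted at most \<open>2 ^ d\<close> times. This
  gives \<open>16 ^ d * 2 ^ d = 32 ^ d\<close>.\<close>

lemma fourth_moment_le:
  fixes q \<delta> :: real and N :: "'a set"
  assumes fN: "finite N" and q: "0 < q" "q < 1" and \<delta>: "0 \<le> \<delta>"
    and j: "j \<in> N" and T: "\<And>T. T \<in> \<T> \<Longrightarrow> j \<in> T \<and> card T \<le> d"
    and small: "\<And>S T. S \<subseteq> N \<Longrightarrow> j \<in> S \<Longrightarrow> T \<in> \<T> \<Longrightarrow> S \<subseteq> T \<Longrightarrow>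
      (\<Sum>T\<in>Pow N. of_bool (S \<subseteq> T \<and> card T \<le> d) * ((q * (1 - q)) ^ card T * (\<alpha> T)\<^sup>2))
        \<le> \<delta> * (q * (1 - q)) ^ card S"
  shows "bmean q N (\<lambda>X. expansion q N (\<lambda>T. of_bool (T \<in> \<T>) * \<alpha> T) X ^ 4) \<le>
    32 ^ d * \<delta> * (\<Sum>T\<in>Pow N. (q * (1 - q)) ^ card T * (of_bool (T \<in> \<T>) * (\<alpha> T)\<^sup>2))"
proof -
  define s where "s = q * (1 - q)"
  have s: "0 < s" "s \<le> 1" using q by (auto simp: s_def intro: mult_le_one)
  define a where "a T = of_bool (T \<in> \<T>) * \<alpha> T" for T
  define w where "w S = (\<Sum>T\<in>Pow N. of_bool (S \<subseteq> T) * (s ^ card T * (a T)\<^sup>2))" for S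
  have w0: "0 \<le> w S" for S unfolding w_def using s by (intro sum_nonneg) auto
  have W0: "0 \<le> upweight s N a S" for S unfolding upweight_def using s by (intro sum_nonneg) auto
  have Wle: "upweight s N a S \<le> 4 ^ d * w S" for S
    unfolding upweight_def w_def sum_distrib_left
  proof (rule sum_mono)
    fix T assume "T \<in> Pow N"
    show "of_bool (S \<subseteq> T) * ((4 * s) ^ card T * (a T)\<^sup>2) \<le> 4 ^ d * (of_bool (S \<subseteq> T) * (s ^ card T * (a T)\<^sup>2))"
    proof (cases "T \<in> \<T>")
      case True
      then have "(4::real) ^ card T \<le> 4 ^ d" using T by (intro power_increasing) auto
      then have "4 ^ card T * (of_bool (S \<subseteq> T) * (s ^ card T * (a T)\<^sup>2)) \<le>
        4 ^ d * (of_bool (S \<subseteq> T) * (s ^ card T * (a T)\<^sup>2))"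
        using s by (intro mult_right_mono) auto
      then show ?thesis by (simp add: power_mult_distrib mult_ac)
    qed (simp add: a_def)
  qed
  \<comment> \<open>All sets of \<open>\<T>\<close> contain \<open>j\<close>, so smallness is
    required only at sets \<open>S\<close> through \<open>j\<close>.\<close>
  have ins: "upweight s N a (insert j S) = upweight s N a S" "w (insert j S) = w S" for S
    unfolding upweight_def w_def using T by (auto intro!: sum.cong simp: a_def)
  \<comment> \<open>Either \<open>insert j S\<close> lies below a member of \<open>\<T>\<close>, so
    that \<open>small\<close> applies, or no member lies above it and the weight vanishes.\<close>
  have bound: "upweight s N a S * upweight s N a S / s ^ card S \<le> 16 ^ d * \<delta> * w S" if S: "S \<subseteq> N" for S
  proof (cases "\<exists>T\<in>\<T>. T \<subseteq> N \<and> insert j S \<subseteq> T")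
    case False
    then have "upweight s N a (insert j S) = 0"
      unfolding upweight_def by (intro sum.neutral) (auto simp: a_def)
    then show ?thesis using ins w0 \<delta> by simp
  next
    case True
    then obtain T' where T': "T' \<in> \<T>" "insert j S \<subseteq> T'" by blast
    have fS: "finite S" using S fN finite_subset by blast
    have "w (insert j S) \<le> (\<Sum>T\<in>Pow N. of_bool (insert j S \<subseteq> T \<and> card T \<le> d) * (s ^ card T * (\<alpha> T)\<^sup>2))"
      unfolding w_def using s T by (intro sum_mono) (auto simp: a_def)
    also have "\<dots> \<le> \<delta> * s ^ card (insert j S)"
      unfolding s_def using T' S j by (intro small) auto
    also have "\<dots> \<le> \<delta> * s ^ card S"
      using s \<delta> fS by (intro mult_left_mono power_decreasing card_mono) auto
    finally have wle: "w S \<le> \<delta> * s ^ card S" by (simp add: ins)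
    have "upweight s N a S * upweight s N a S \<le> (4 ^ d * w S) * (4 ^ d * w S)"
      by (intro mult_mono Wle W0) (simp add: w0)
    also have "\<dots> = 16 ^ d * w S * w S"
      by (simp add: mult_ac flip: power_mult_distrib)
    also have "\<dots> \<le> 16 ^ d * w S * (\<delta> * s ^ card S)"
      using wle w0 by (intro mult_left_mono) auto
    finally show ?thesis using s by (simp add: divide_le_eq mult_ac)
  qed
  have "bmean q N (\<lambda>X. expansion q N a X ^ 4) = bmean q N (\<lambda>X. (expansion q N a X)\<^sup>2 * (expansion q N a X)\<^sup>2)"
    by (simp add: power4_eq_xxxx power2_eq_square mult.assoc)
  also have "\<dots> \<le> (\<Sum>S\<in>Pow N. upweight s N a S * upweight s N a S / s ^ card S)"
    unfolding s_def using fN q by (rule global_hypercontractivity)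
  also have "\<dots> \<le> (\<Sum>S\<in>Pow N. 16 ^ d * \<delta> * w S)"
    using bound by (intro sum_mono) auto
  also have "\<dots> = 16 ^ d * \<delta> * (\<Sum>T\<in>Pow N. \<Sum>S\<in>Pow N. of_bool (S \<subseteq> T) * (s ^ card T * (a T)\<^sup>2))"
    unfolding w_def sum_distrib_left[symmetric] by (rule arg_cong[OF sum.swap])
  also have "\<dots> \<le> 16 ^ d * \<delta> * (\<Sum>T\<in>Pow N. 2 ^ d * (s ^ card T * (a T)\<^sup>2))"
  proof (intro mult_left_mono sum_mono)
    fix T assume TN: "T \<in> Pow N"
    show "(\<Sum>S\<in>Pow N. of_bool (S \<subseteq> T) * (s ^ card T * (a T)\<^sup>2)) \<le> 2 ^ d * (s ^ card T * (a T)\<^sup>2)"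
    proof (cases "T \<in> \<T>")
      case True
      have "Pow N \<inter> {S. S \<subseteq> T} = Pow T" using TN by auto
      moreover have "finite T" using TN fN finite_subset by auto
      ultimately have "(\<Sum>S\<in>Pow N. of_bool (S \<subseteq> T) * (s ^ card T * (a T)\<^sup>2)) = 2 ^ card T * (s ^ card T * (a T)\<^sup>2)"
        using fN by (simp add: card_Pow)
      also have "\<dots> \<le> 2 ^ d * (s ^ card T * (a T)\<^sup>2)"
        using T[OF True] s by (intro mult_right_mono power_increasing) auto
      finally show ?thesis .
    qed (simp add: a_def)
  qed (use \<delta> in auto)
  also have "\<dots> = 32 ^ d * \<delta> * (\<Sum>T\<in>Pow N. s ^ card T * (of_bool (T \<in> \<T>) * (\<alpha> T)\<^sup>2))"
  proof -
    have "(a T)\<^sup>2 = of_bool (T \<in> \<T>) * (\<alpha> T)\<^sup>2" for T by (simp add: a_def)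
    moreover have "(32::real) ^ d = 16 ^ d * 2 ^ d" by (simp flip: power_mult_distrib)
    ultimately show ?thesis
      unfolding sum_distrib_left[symmetric] by (simp only: mult_ac)
  qed
  finally show ?thesis unfolding s_def a_def[abs_def] .
qed

text \<open>Each \<open>T\<close> is counted once for every \<open>j \<in> T\<close>, and the weight
  of all sets containing \<open>j\<close> is at most the influence of \<open>j\<close>.\<close>

lemma level_weight_le:
  fixes q :: real and N :: "'a set"
  assumes fN: "finite N" and q: "0 < q" "q < 1"
    and \<phi>: "\<And>X. X \<subseteq> N \<Longrightarrow> \<phi> X = expansion q N \<alpha> X" "\<And>X. X \<subseteq> N \<Longrightarrow> \<phi> X \<in> {0, 1}"
  shows "(\<Sum>T\<in>Pow N. real (card T) * ((q * (1 - q)) ^ card T * (\<alpha> T)\<^sup>2)) \<le>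
    (\<Sum>j\<in>N. bmean q N (local_var q \<phi> j))"
proof -
  have "real (card T) * c = (\<Sum>j\<in>N. of_bool (j \<in> T) * c)" if "T \<in> Pow N" for T and c :: real
  proof -
    have "N \<inter> {j. j \<in> T} = T" using that by auto
    then show ?thesis using fN by simp
  qed
  then have "(\<Sum>T\<in>Pow N. real (card T) * ((q * (1 - q)) ^ card T * (\<alpha> T)\<^sup>2)) =
    (\<Sum>T\<in>Pow N. \<Sum>j\<in>N. of_bool (j \<in> T) * ((q * (1 - q)) ^ card T * (\<alpha> T)\<^sup>2))"
    by (intro sum.cong) auto
  also have "\<dots> = (\<Sum>j\<in>N. \<Sum>T\<in>Pow N. (q * (1 - q)) ^ card T * (of_bool (T \<in> {T. j \<in> T}) * (\<alpha> T)\<^sup>2))"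
    by (subst sum.swap) (simp add: mult_ac)
  also have "\<dots> \<le> (\<Sum>j\<in>N. bmean q N (local_var q \<phi> j))"
    by (intro sum_mono derivative_weight_le(1)[OF fN q \<phi>]) simp_all
  finally show ?thesis .
qed

section \<open>Approximation by functions of the core\<close>

lemma bmean_sq_expansion:
  assumes "finite N"
  shows "bmean q N (\<lambda>X. (expansion q N \<alpha> X)\<^sup>2) = (\<Sum>T\<in>Pow N. (q * (1 - q)) ^ card T * (\<alpha> T)\<^sup>2)"
  using Parseval[OF assms, of q \<alpha> \<alpha>] by (simp add: power2_eq_square)

text \<open>The Poincare inequality, with the coefficient of the empty set as the constant. It
  settles the case of total influence 0.\<close>

lemma constant_approximation:
  fixes q :: real and N :: "'a set"
  assumes fN: "finite N" and q: "0 < q" "q < 1"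
    and \<phi>: "\<And>X. X \<subseteq> N \<Longrightarrow> \<phi> X \<in> {0, 1}"
  shows "\<exists>c. bmean q N (\<lambda>X. (\<phi> X - c)\<^sup>2) \<le> (\<Sum>j\<in>N. bmean q N (local_var q \<phi> j))"
proof -
  define s where "s = q * (1 - q)"
  have s: "0 < s" using q by (simp add: s_def)
  obtain \<alpha> where \<alpha>: "\<And>X. X \<subseteq> N \<Longrightarrow> \<phi> X = expansion q N \<alpha> X"
    using expansion_exists[OF fN, of \<phi> q] by metis
  define a where "a T = of_bool (T \<noteq> {}) * \<alpha> T" for T
  have "\<phi> X - \<alpha> {} = expansion q N a X" if X: "X \<subseteq> N" for X
  proof -
    have "expansion q N \<alpha> X - expansion q N a X = (\<Sum>T\<in>Pow N. of_bool (T = {}) * (\<alpha> T * chr q T X))"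
      unfolding expansion_def sum_subtractf[symmetric] by (rule sum.cong) (auto simp: a_def)
    also have "\<dots> = \<alpha> {}"
    proof -
      have "Pow N \<inter> {T. T = {}} = {{}}" by auto
      then show ?thesis using fN by simp
    qed
    finally show ?thesis using \<alpha>[OF X] by simp
  qed
  then have "bmean q N (\<lambda>X. (\<phi> X - \<alpha> {})\<^sup>2) = bmean q N (\<lambda>X. (expansion q N a X)\<^sup>2)"
    by (intro bmean_cong) auto
  also have "\<dots> = (\<Sum>T\<in>Pow N. s ^ card T * (a T)\<^sup>2)"
    unfolding s_def by (rule bmean_sq_expansion[OF fN])
  also have "\<dots> \<le> (\<Sum>T\<in>Pow N. real (card T) * (s ^ card T * (\<alpha> T)\<^sup>2))"
  proof (rule sum_mono)
    fix T assume "T \<in> Pow N"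
    then have "finite T" using fN finite_subset by auto
    then have "of_bool (T \<noteq> {}) \<le> real (card T)"
      using card_gt_0_iff[of T] by (auto simp: Suc_le_eq)
    then have "of_bool (T \<noteq> {}) * (s ^ card T * (\<alpha> T)\<^sup>2) \<le> real (card T) * (s ^ card T * (\<alpha> T)\<^sup>2)"
      using s by (intro mult_right_mono) auto
    then show "s ^ card T * (a T)\<^sup>2 \<le> real (card T) * (s ^ card T * (\<alpha> T)\<^sup>2)"
      by (cases "T = {}") (simp_all add: a_def)
  qed
  also have "\<dots> \<le> (\<Sum>j\<in>N. bmean q N (local_var q \<phi> j))"
    unfolding s_def using fN q \<alpha> \<phi> by (rule level_weight_le)
  finally show ?thesis by blast
qed

text \<open>A set \<open>T\<close> that is not a union of active sets has a point \<open>j\<close>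
  in no active subset of \<open>T\<close>, so it belongs to \<open>\<T> j\<close>. The threshold
  cancels the \<open>32 ^ d\<close> of \<open>fourth_moment_le\<close>, and the weight
  \<open>\<beta> j\<close> then satisfies \<open>\<beta> j ^ 4 \<le> I ^ 3 * \<tau> ^ 4 * \<beta> j
  \<le> (\<tau> * I) ^ 4\<close>, with \<open>I\<close> the influence of \<open>j\<close>.\<close>

lemma uncovered_weight_le:
  fixes q \<tau> :: real and N :: "'a set"
  assumes fN: "finite N" and q: "0 < q" "q < 1" and \<tau>: "0 < \<tau>"
    and \<phi>: "\<And>X. X \<subseteq> N \<Longrightarrow> \<phi> X = expansion q N \<alpha> X" "\<And>X. X \<subseteq> N \<Longrightarrow> \<phi> X \<in> {0, 1}"
    and A: "\<And>S. S \<subseteq> N \<Longrightarrow> card S \<le> d \<Longrightarrow> S \<notin> A \<Longrightarrow>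
      (\<Sum>T\<in>Pow N. of_bool (S \<subseteq> T \<and> card T \<le> d) * ((q * (1 - q)) ^ card T * (\<alpha> T)\<^sup>2))
        \<le> \<tau> ^ 4 / 32 ^ d * (q * (1 - q)) ^ card S"
  shows "(\<Sum>T\<in>{T. T \<subseteq> N \<and> card T \<le> d \<and> core A T \<noteq> T}. (q * (1 - q)) ^ card T * (\<alpha> T)\<^sup>2)
    \<le> \<tau> * (\<Sum>j\<in>N. bmean q N (local_var q \<phi> j))"
proof -
  define s where "s = q * (1 - q)"
  have s: "0 < s" using q by (simp add: s_def)
  define \<T> where "\<T> j = {T. T \<subseteq> N \<and> j \<in> T \<and> card T \<le> d \<and> (\<forall>S\<in>A. j \<in> S \<longrightarrow> \<not> S \<subseteq> T)}" for j
  define \<beta> where "\<beta> j = (\<Sum>T\<in>Pow N. s ^ card T * (of_bool (T \<in> \<T> j) * (\<alpha> T)\<^sup>2))" for j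
  have "(\<Sum>T\<in>{T. T \<subseteq> N \<and> card T \<le> d \<and> core A T \<noteq> T}. s ^ card T * (\<alpha> T)\<^sup>2) \<le>
    (\<Sum>T\<in>{T. T \<subseteq> N \<and> card T \<le> d \<and> core A T \<noteq> T}. \<Sum>j\<in>N. s ^ card T * (of_bool (T \<in> \<T> j) * (\<alpha> T)\<^sup>2))"
  proof (rule sum_mono)
    fix T assume T: "T \<in> {T. T \<subseteq> N \<and> card T \<le> d \<and> core A T \<noteq> T}"
    then obtain j where j: "j \<in> T" "j \<notin> core A T" using core_subset[of A T] by auto
    then have jT: "T \<in> \<T> j" "j \<in> N" using T by (auto simp: \<T>_def core_def)
    have "s ^ card T * (\<alpha> T)\<^sup>2 = (\<Sum>j\<in>{j}. s ^ card T * (of_bool (T \<in> \<T> j) * (\<alpha> T)\<^sup>2))"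
      using jT by simp
    also have "\<dots> \<le> (\<Sum>j\<in>N. s ^ card T * (of_bool (T \<in> \<T> j) * (\<alpha> T)\<^sup>2))"
      using jT s fN by (intro sum_mono2) auto
    finally show "s ^ card T * (\<alpha> T)\<^sup>2 \<le> \<dots>" .
  qed
  also have "\<dots> \<le> (\<Sum>T\<in>Pow N. \<Sum>j\<in>N. s ^ card T * (of_bool (T \<in> \<T> j) * (\<alpha> T)\<^sup>2))"
    using s fN by (intro sum_mono2) (auto intro!: sum_nonneg)
  also have "\<dots> = (\<Sum>j\<in>N. \<beta> j)"
    unfolding \<beta>_def by (rule sum.swap)
  also have "\<dots> \<le> (\<Sum>j\<in>N. \<tau> * bmean q N (local_var q \<phi> j))"
  proof (rule sum_mono)
    fix j assume j: "j \<in> N"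
    define I where "I = bmean q N (local_var q \<phi> j)"
    have jT: "\<And>T. T \<in> \<T> j \<Longrightarrow> j \<in> T" by (simp add: \<T>_def)
    have b1: "\<beta> j \<le> I"
      unfolding \<beta>_def I_def s_def by (rule derivative_weight_le(1)) (rule fN q \<phi> j jT | assumption)+
    have b2: "\<beta> j ^ 4 \<le> I ^ 3 * bmean q N (\<lambda>X. expansion q N (\<lambda>T. of_bool (T \<in> \<T> j) * \<alpha> T) X ^ 4)"
      unfolding \<beta>_def I_def s_def by (rule derivative_weight_le(2)) (rule fN q \<phi> j jT | assumption)+
    have \<beta>0: "0 \<le> \<beta> j" unfolding \<beta>_def using s by (intro sum_nonneg) auto
    then have I0: "0 \<le> I" using b1 by simp
    have "bmean q N (\<lambda>X. expansion q N (\<lambda>T. of_bool (T \<in> \<T> j) * \<alpha> T) X ^ 4) \<le>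
      32 ^ d * (\<tau> ^ 4 / 32 ^ d) * \<beta> j"
      unfolding \<beta>_def s_def
    proof (rule fourth_moment_le[OF fN q _ j])
      \<comment> \<open>A subset of a member of \<open>\<T> j\<close> that contains \<open>j\<close>
        cannot be active, so hypothesis \<open>A\<close> applies to it.\<close>
      fix S T assume S: "S \<subseteq> N" "j \<in> S" "T \<in> \<T> j" "S \<subseteq> T"
      then have "finite T" using fN finite_subset by (auto simp: \<T>_def)
      then have "card S \<le> card T" using S by (intro card_mono)
      then show "(\<Sum>T\<in>Pow N. of_bool (S \<subseteq> T \<and> card T \<le> d) * ((q * (1 - q)) ^ card T * (\<alpha> T)\<^sup>2))
        \<le> \<tau> ^ 4 / 32 ^ d * (q * (1 - q)) ^ card S"
        using S by (intro A) (auto simp: \<T>_def)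
    qed (use \<tau> in \<open>auto simp: \<T>_def\<close>)
    also have "32 ^ d * (\<tau> ^ 4 / 32 ^ d) * \<beta> j = \<tau> ^ 4 * \<beta> j" by simp
    finally have "\<beta> j ^ 4 \<le> I ^ 3 * (\<tau> ^ 4 * \<beta> j)"
      using b2 I0 by (meson mult_left_mono order.trans zero_le_power)
    also have "\<dots> \<le> I ^ 3 * (\<tau> ^ 4 * I)"
      using b1 I0 by (intro mult_left_mono) auto
    also have "\<dots> = (\<tau> * I) ^ 4" by (simp add: power_mult_distrib power3_eq_cube power4_eq_xxxx)
    finally show "\<beta> j \<le> \<tau> * I"
      using \<tau> I0 by (meson power_mono_iff mult_nonneg_nonneg less_imp_le zero_less_numeral \<beta>0)
  qed
  finally show ?thesis by (simp add: s_def sum_distrib_left)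
qed

text \<open>Heaviness bounds \<open>s ^ card S\<close> by the weight above \<open>S\<close> divided
  by \<open>\<delta>\<close>. Summed over all \<open>S\<close>, these weights count each
  \<open>T\<close> at most \<open>2 ^ d\<close> times; the other \<open>2 ^ d\<close> comes from
  \<open>q \<le> 2 * s\<close>.\<close>

lemma heavy_sets_weight_le:
  fixes q \<delta> :: real and N :: "'a set"
  assumes fN: "finite N" and q: "0 < q" "q \<le> 1 / 2" and \<delta>: "0 < \<delta>"
    and one: "(\<Sum>T\<in>Pow N. (q * (1 - q)) ^ card T * (\<alpha> T)\<^sup>2) \<le> 1"
  shows "(\<Sum>S\<in>{S. S \<subseteq> N \<and> card S \<le> d \<and> \<delta> * (q * (1 - q)) ^ card S \<le>
      (\<Sum>T\<in>Pow N. of_bool (S \<subseteq> T \<and> card T \<le> d) * ((q * (1 - q)) ^ card T * (\<alpha> T)\<^sup>2))}. q ^ card S)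
    \<le> 4 ^ d / \<delta>"
proof -
  define s where "s = q * (1 - q)"
  have s: "0 < s" using q by (simp add: s_def)
  have qs: "q \<le> 2 * s"
    using q mult_left_mono[of "1/2" "1 - q" q] by (simp add: s_def)
  define \<omega> where "\<omega> S = (\<Sum>T\<in>Pow N. of_bool (S \<subseteq> T \<and> card T \<le> d) * (s ^ card T * (\<alpha> T)\<^sup>2))" for S
  have \<omega>0: "0 \<le> \<omega> S" for S unfolding \<omega>_def using s by (intro sum_nonneg) auto
  define B where "B = {S. S \<subseteq> N \<and> card S \<le> d \<and> \<delta> * s ^ card S \<le> \<omega> S}"
  have "(\<Sum>S\<in>B. q ^ card S) \<le> (\<Sum>S\<in>B. 2 ^ d / \<delta> * \<omega> S)"
  proof (rule sum_mono)
    fix S assume S: "S \<in> B"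
    have "q ^ card S \<le> (2 * s) ^ card S" using q qs by (intro power_mono) auto
    also have "\<dots> \<le> 2 ^ d * s ^ card S"
      unfolding power_mult_distrib using s S by (intro mult_right_mono power_increasing) (auto simp: B_def)
    also have "\<dots> \<le> 2 ^ d * (\<omega> S / \<delta>)"
      using S \<delta> by (intro mult_left_mono) (auto simp: B_def field_simps)
    finally show "q ^ card S \<le> 2 ^ d / \<delta> * \<omega> S" by simp
  qed
  also have "\<dots> \<le> (\<Sum>S\<in>Pow N. 2 ^ d / \<delta> * \<omega> S)"
    using fN \<omega>0 \<delta> by (intro sum_mono2) (auto simp: B_def)
  also have "\<dots> = 2 ^ d / \<delta> * (\<Sum>S\<in>Pow N. \<omega> S)" by (simp add: sum_distrib_left)
  also have "(\<Sum>S\<in>Pow N. \<omega> S) = (\<Sum>T\<in>Pow N. \<Sum>S\<in>Pow N. of_bool (S \<subseteq> T \<and> card T \<le> d) * (s ^ card T * (\<alpha> T)\<^sup>2))"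
    unfolding \<omega>_def by (rule sum.swap)
  also have "\<dots> \<le> (\<Sum>T\<in>Pow N. 2 ^ d * (s ^ card T * (\<alpha> T)\<^sup>2))"
  proof (rule sum_mono)
    fix T assume T: "T \<in> Pow N"
    show "(\<Sum>S\<in>Pow N. of_bool (S \<subseteq> T \<and> card T \<le> d) * (s ^ card T * (\<alpha> T)\<^sup>2)) \<le> 2 ^ d * (s ^ card T * (\<alpha> T)\<^sup>2)"
    proof (cases "card T \<le> d")
      case True
      have "Pow N \<inter> {S. S \<subseteq> T} = Pow T" using T by auto
      moreover have "finite T" using T fN finite_subset by auto
      ultimately have "(\<Sum>S\<in>Pow N. of_bool (S \<subseteq> T \<and> card T \<le> d) * (s ^ card T * (\<alpha> T)\<^sup>2)) =
        2 ^ card T * (s ^ card T * (\<alpha> T)\<^sup>2)"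
        using fN True by (simp add: card_Pow)
      also have "\<dots> \<le> 2 ^ d * (s ^ card T * (\<alpha> T)\<^sup>2)"
        using True s by (intro mult_right_mono power_increasing) auto
      finally show ?thesis .
    qed (use s in simp)
  qed
  also have "\<dots> = 2 ^ d * (\<Sum>T\<in>Pow N. s ^ card T * (\<alpha> T)\<^sup>2)" by (simp add: sum_distrib_left)
  also have "\<dots> \<le> 2 ^ d * 1" using one by (intro mult_left_mono) (auto simp: s_def)
  finally have "(\<Sum>S\<in>B. q ^ card S) \<le> 2 ^ d / \<delta> * (2 ^ d * 1)"
    using \<delta> by (simp add: divide_right_mono)
  also have "\<dots> = 4 ^ d / \<delta>" by (simp flip: power_mult_distrib)
  finally show ?thesis by (simp add: B_def \<omega>_def s_def)
qed

text \<open>Union bound: an active \<open>S\<close> lies in \<open>X\<close> with probability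
  \<open>q ^ card S\<close> and then adds at most \<open>d\<close> points.\<close>

lemma bmean_card_core_le:
  fixes q :: real and N :: "'a set"
  assumes fN: "finite N" and q: "0 \<le> q" "q \<le> 1" and A: "\<And>S. S \<in> A \<Longrightarrow> S \<subseteq> N \<and> card S \<le> d"
  shows "bmean q N (\<lambda>X. real (card (core A X))) \<le> real d * (\<Sum>S\<in>A. q ^ card S)"
proof -
  have finA: "finite A" using A fN by (intro finite_subset[of A "Pow N"]) auto
  have "bmean q N (\<lambda>X. real (card (core A X))) \<le> bmean q N (\<lambda>X. \<Sum>S\<in>A. real d * of_bool (S \<subseteq> X))"
  proof (rule bmean_mono[OF q])
    fix X assume "X \<subseteq> N"
    have "card (core A X) \<le> (\<Sum>S\<in>{S\<in>A. S \<subseteq> X}. card S)"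
      unfolding core_def using finA card_UN_le[of "{S\<in>A. S \<subseteq> X}" id] by simp
    then have "real (card (core A X)) \<le> (\<Sum>S\<in>{S\<in>A. S \<subseteq> X}. real (card S))"
      by (simp flip: of_nat_sum)
    also have "\<dots> \<le> (\<Sum>S\<in>{S\<in>A. S \<subseteq> X}. real d)"
      using A by (intro sum_mono) auto
    also have "\<dots> = (\<Sum>S\<in>A. real d * of_bool (S \<subseteq> X))"
      using finA by (simp add: Int_def mult.commute flip: sum_distrib_left)
    finally show "real (card (core A X)) \<le> \<dots>" .
  qed
  also have "\<dots> = (\<Sum>S\<in>A. real d * q ^ card S)"
    unfolding bmean_sum bmean_cmult using A by (intro sum.cong) (auto simp: bmean_indicator[OF fN])
  finally show ?thesis by (simp add: sum_distrib_left)
qed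

text \<open>Everything is rounded up to powers of 2 using \<open>real d \<le> 2 ^ d\<close>. The
  three factors have exponents at most \<open>d\<close>, \<open>10 * d\<^sup>2\<close> and
  \<open>12 * d\<close>, together at most \<open>23 * d\<^sup>2\<close>.\<close>

lemma junta_size_arith:
  fixes d :: nat
  assumes "1 \<le> d"
  shows "real d * ((1 + 2 ^ d / (1 / (2 ^ (5 * d + 2) * real d))) ^ d *
    (1 + 4 ^ d / ((1 / real d) ^ 4 / 32 ^ d))) \<le> exp (23 * (real d)\<^sup>2)"
proof -
  have d: "real d \<le> 2 ^ d" by (simp add: less_imp_le)
  have "1 + 2 ^ d / (1 / (2 ^ (5 * d + 2) * real d)) = 1 + 2 ^ d * (2 ^ (5 * d + 2) * real d)"
    by simp
  also have "\<dots> \<le> 2 ^ (7 * d + 2) + 2 ^ d * (2 ^ (5 * d + 2) * 2 ^ d)"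
    using d by (intro add_mono mult_left_mono one_le_power) auto
  also have "\<dots> = 2 ^ (7 * d + 3)"
  proof -
    have "(2::real) ^ d * (2 ^ (5 * d + 2) * 2 ^ d) = 2 ^ (d + (5 * d + 2 + d))" by (simp only: power_add)
    also have "d + (5 * d + 2 + d) = 7 * d + 2" by simp
    finally show ?thesis by (simp add: power_add)
  qed
  also have "\<dots> \<le> 2 ^ (10 * d)" using assms by (intro power_increasing) auto
  finally have "(1 + 2 ^ d / (1 / (2 ^ (5 * d + 2) * real d))) ^ d \<le> (2 ^ (10 * d)) ^ d"
    by (intro power_mono) auto
  moreover have "1 + 4 ^ d / ((1 / real d) ^ 4 / 32 ^ d) \<le> 2 ^ (12 * d)"
  proof -
    have "1 + 4 ^ d / ((1 / real d) ^ 4 / 32 ^ d) = 1 + 4 ^ d * 32 ^ d * real d ^ 4"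
      using assms by (simp add: power_divide)
    also have "\<dots> \<le> 2 ^ (11 * d) + 4 ^ d * 32 ^ d * (2 ^ d) ^ 4"
      using d by (intro add_mono mult_left_mono power_mono) auto
    also have "4 ^ d * 32 ^ d * (2 ^ d) ^ 4 = ((2::real) ^ 11) ^ d"
      by (simp add: power_mult[symmetric] mult.commute[of d] flip: power_mult_distrib) (simp add: power_mult flip: power_mult_distrib)
    also have "((2::real) ^ 11) ^ d = 2 ^ (11 * d)" by (simp only: power_mult)
    also have "2 ^ (11 * d) + 2 ^ (11 * d) = (2::real) ^ (11 * d + 1)" by simp
    also have "\<dots> \<le> 2 ^ (12 * d)" using assms by (intro power_increasing) auto
    finally show ?thesis .
  qed
  ultimately have "real d * ((1 + 2 ^ d / (1 / (2 ^ (5 * d + 2) * real d))) ^ d *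
    (1 + 4 ^ d / ((1 / real d) ^ 4 / 32 ^ d))) \<le> 2 ^ d * ((2 ^ (10 * d)) ^ d * 2 ^ (12 * d))"
    using d by (intro mult_mono) auto
  also have "\<dots> = 2 ^ (d + (10 * d * d + 12 * d))" by (simp only: power_add power_mult)
  also have "\<dots> \<le> 2 ^ (23 * d\<^sup>2)"
  proof (rule power_increasing)
    have "d * 1 \<le> d * d" using assms by (intro mult_left_mono) auto
    then show "d + (10 * d * d + 12 * d) \<le> 23 * d\<^sup>2" by (simp add: power2_eq_square)
  qed simp
  also have "\<dots> \<le> exp 1 ^ (23 * d\<^sup>2)"
    using exp_ge_add_one_self[of 1] by (intro power_mono) auto
  also have "\<dots> = exp (23 * (real d)\<^sup>2)"
    by (simp flip: exp_of_nat_mult)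
  finally show ?thesis .
qed

text \<open>The approximation in mean square, before rounding to values in \<open>{0, 1}\<close>,
  with the truncation level \<open>d\<close> still free.\<close>

lemma junta_approximation:
  fixes q :: real and N :: "'a set" and d :: nat
  assumes fN: "finite N" and q: "0 < q" "q \<le> 1 / 2" and d: "1 \<le> d"
    and \<phi>: "\<And>X. X \<subseteq> N \<Longrightarrow> \<phi> X \<in> {0, 1}"
  defines "I \<equiv> (\<Sum>j\<in>N. bmean q N (local_var q \<phi> j))"
  shows "\<exists>A g. (\<forall>S\<in>A. S \<subseteq> N) \<and> (\<forall>X. g (core A X) = g X) \<and>
    bmean q N (\<lambda>X. real (card (core A X))) \<le> exp (23 * (real d)\<^sup>2) \<and>
    bmean q N (\<lambda>X. (\<phi> X - g X)\<^sup>2) \<le> (4 * I + 1) / real d"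
proof -
  have q1: "q < 1" using q by simp
  define s where "s = q * (1 - q)"
  have s: "0 < s" using q by (simp add: s_def)
  define \<tau> where "\<tau> = 1 / real d"
  define \<delta> where "\<delta> = \<tau> ^ 4 / 32 ^ d"
  \<comment> \<open>Chosen so that the factor \<open>2 ^ (5 * d + 1) * \<gamma>\<close> of
    \<open>core_chr_error\<close> is \<open>1 / (2 * d)\<close>.\<close>
  define \<gamma> where "\<gamma> = 1 / (2 ^ (5 * d + 2) * real d)"
  have pos: "0 < \<tau>" "0 < \<delta>" "0 < \<gamma>" using d by (auto simp: \<tau>_def \<delta>_def \<gamma>_def)
  obtain \<alpha> where \<alpha>: "\<And>X. X \<subseteq> N \<Longrightarrow> \<phi> X = expansion q N \<alpha> X"
    using expansion_exists[OF fN, of \<phi> q] by metis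
  have one: "(\<Sum>T\<in>Pow N. s ^ card T * (\<alpha> T)\<^sup>2) \<le> 1"
  proof -
    have "(\<Sum>T\<in>Pow N. s ^ card T * (\<alpha> T)\<^sup>2) = bmean q N (\<lambda>X. (expansion q N \<alpha> X)\<^sup>2)"
      unfolding s_def by (rule bmean_sq_expansion[OF fN, symmetric])
    also have "\<dots> = bmean q N (\<lambda>X. (\<phi> X)\<^sup>2)"
      by (rule bmean_cong) (simp only: \<alpha>)
    also have "\<dots> \<le> bmean q N (\<lambda>X. 1)"
    proof (rule bmean_mono)
      fix X assume "X \<subseteq> N"
      from \<phi>[OF this] show "(\<phi> X)\<^sup>2 \<le> 1" by auto
    qed (use q in auto)
    finally show ?thesis using fN by (simp add: bmean_const)
  qed
  define A0 where "A0 = insert {} {S. S \<subseteq> N \<and> card S \<le> d \<and> \<delta> * s ^ card S \<le>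
      (\<Sum>T\<in>Pow N. of_bool (S \<subseteq> T \<and> card T \<le> d) * (s ^ card T * (\<alpha> T)\<^sup>2))}" (is "_ = insert {} ?B")
  have finB: "finite ?B" using fN by simp
  \<comment> \<open>The summand 1 is the weight of the empty set.\<close>
  have A0w: "(\<Sum>S\<in>A0. q ^ card S) \<le> 1 + 4 ^ d / \<delta>"
  proof -
    have "(\<Sum>S\<in>A0. q ^ card S) \<le> 1 + (\<Sum>S\<in>?B. q ^ card S)"
      unfolding A0_def using finB q by (simp add: sum.insert_if)
    also have "(\<Sum>S\<in>?B. q ^ card S) \<le> 4 ^ d / \<delta>"
      unfolding s_def using fN q pos(2) one[unfolded s_def] by (rule heavy_sets_weight_le)
    finally show ?thesis by simp
  qed
  have A0N: "\<And>S. S \<in> A0 \<Longrightarrow> S \<subseteq> N \<and> card S \<le> d" by (auto simp: A0_def)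
  obtain A where A: "A0 \<subseteq> A" "\<And>S. S \<in> A \<Longrightarrow> S \<subseteq> N \<and> card S \<le> d"
    and sat: "\<And>U. U \<subseteq> N \<Longrightarrow> U \<notin> A \<Longrightarrow> (\<Sum>S\<in>{S\<in>A. U \<subset> S}. q ^ card (S - U)) \<le> \<gamma>"
    and wt: "(\<Sum>S\<in>A. q ^ card S) \<le> (1 + 2 ^ d / \<gamma>) ^ d * (\<Sum>S\<in>A0. q ^ card S)"
    by (rule saturation[OF fN q(1) pos(3) A0N], assumption, rule that; simp)
  define C where "C = {T. T \<subseteq> N \<and> card T \<le> d \<and> core A T = T}"
  define g where "g X = (\<Sum>T\<in>C. \<alpha> T * core_chr q A T X)" for X
  have finC: "finite C" using fN by (simp add: C_def)
  have size: "bmean q N (\<lambda>X. real (card (core A X))) \<le> exp (23 * (real d)\<^sup>2)"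
  proof -
    have "bmean q N (\<lambda>X. real (card (core A X))) \<le> real d * (\<Sum>S\<in>A. q ^ card S)"
      using A(2) q q1 by (intro bmean_card_core_le[OF fN]) auto
    also have "\<dots> \<le> real d * ((1 + 2 ^ d / \<gamma>) ^ d * (1 + 4 ^ d / \<delta>))"
      using pos by (intro mult_left_mono order.trans[OF wt] A0w) auto
    also have "\<dots> \<le> exp (23 * (real d)\<^sup>2)"
      unfolding \<gamma>_def \<delta>_def \<tau>_def using d by (rule junta_size_arith)
    finally show ?thesis .
  qed
  \<comment> \<open>The error splits into the discarded characters, with coefficients
    \<open>a\<close>, and the error \<open>E\<close> of making the kept characters functions of the
    core.\<close>
  define a where "a T = of_bool (T \<notin> C) * \<alpha> T" for T
  define E where "E X = (\<Sum>T\<in>C. \<alpha> T * (chr q T X - core_chr q A T X))" for X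
  have dec: "\<phi> X - g X = expansion q N a X + E X" if X: "X \<subseteq> N" for X
  proof -
    have "expansion q N \<alpha> X - expansion q N a X = (\<Sum>T\<in>Pow N. of_bool (T \<in> C) * (\<alpha> T * chr q T X))"
      unfolding expansion_def sum_subtractf[symmetric] by (rule sum.cong) (auto simp: a_def)
    also have "\<dots> = (\<Sum>T\<in>C. \<alpha> T * chr q T X)"
    proof -
      have "Pow N \<inter> {T. T \<in> C} = C" by (auto simp: C_def)
      then show ?thesis using fN by simp
    qed
    finally show ?thesis
      using \<alpha>[OF X] by (simp add: E_def g_def right_diff_distrib sum_subtractf)
  qed
  have w0: "0 \<le> s ^ card T * (\<alpha> T)\<^sup>2" for T using s by simp
  \<comment> \<open>Discarded sets either have more than \<open>d\<close> elements, with weight at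
    most \<open>I / d\<close> by Markov's inequality for the level, or are not unions of active
    sets.\<close>
  have "bmean q N (\<lambda>X. (expansion q N a X)\<^sup>2) \<le> I / real d + \<tau> * I"
  proof -
    have "bmean q N (\<lambda>X. (expansion q N a X)\<^sup>2) = (\<Sum>T\<in>Pow N. of_bool (T \<notin> C) * (s ^ card T * (\<alpha> T)\<^sup>2))"
      unfolding bmean_sq_expansion[OF fN] s_def by (rule sum.cong) (auto simp: a_def)
    also have "\<dots> = (\<Sum>T\<in>Pow N. of_bool (card T > d) * (s ^ card T * (\<alpha> T)\<^sup>2)
      + of_bool (T \<subseteq> N \<and> card T \<le> d \<and> core A T \<noteq> T) * (s ^ card T * (\<alpha> T)\<^sup>2))"
      by (rule sum.cong) (auto simp: C_def)
    also have "\<dots> = (\<Sum>T\<in>Pow N. of_bool (card T > d) * (s ^ card T * (\<alpha> T)\<^sup>2)) +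
      (\<Sum>T\<in>{T. T \<subseteq> N \<and> card T \<le> d \<and> core A T \<noteq> T}. s ^ card T * (\<alpha> T)\<^sup>2)"
    proof -
      have "Pow N \<inter> {T. T \<subseteq> N \<and> card T \<le> d \<and> core A T \<noteq> T} = {T. T \<subseteq> N \<and> card T \<le> d \<and> core A T \<noteq> T}"
        by auto
      then show ?thesis using fN
        by (simp only: sum.distrib sum_of_bool_mult_eq finite_Pow_iff)
    qed
    also have "\<dots> \<le> I / real d + \<tau> * I"
    proof (rule add_mono)
      have "(\<Sum>T\<in>Pow N. of_bool (card T > d) * (s ^ card T * (\<alpha> T)\<^sup>2)) \<le>
        (\<Sum>T\<in>Pow N. 1 / real d * (real (card T) * (s ^ card T * (\<alpha> T)\<^sup>2)))"
      proof (rule sum_mono)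
        fix T :: "'a set"
        have "of_bool (card T > d) \<le> real (card T) / real d"
          using d by (auto simp: field_simps)
        from mult_right_mono[OF this w0[of T]]
        show "of_bool (card T > d) * (s ^ card T * (\<alpha> T)\<^sup>2) \<le>
          1 / real d * (real (card T) * (s ^ card T * (\<alpha> T)\<^sup>2))"
          by (simp only: mult_1 times_divide_eq_left)
      qed
      also have "\<dots> \<le> 1 / real d * I"
        unfolding sum_distrib_left[symmetric] I_def s_def
        by (intro mult_left_mono level_weight_le[OF fN q(1) q1 \<alpha> \<phi>]) auto
      finally show "(\<Sum>T\<in>Pow N. of_bool (card T > d) * (s ^ card T * (\<alpha> T)\<^sup>2)) \<le> I / real d" by simp
      show "(\<Sum>T\<in>{T. T \<subseteq> N \<and> card T \<le> d \<and> core A T \<noteq> T}. s ^ card T * (\<alpha> T)\<^sup>2) \<le> \<tau> * I"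
        unfolding I_def s_def
      proof (rule uncovered_weight_le[OF fN q(1) q1 pos(1) \<alpha> \<phi>])
        fix S assume "S \<subseteq> N" "card S \<le> d" "S \<notin> A"
        then have "S \<notin> ?B" using A(1) by (auto simp: A0_def)
        then show "(\<Sum>T\<in>Pow N. of_bool (S \<subseteq> T \<and> card T \<le> d) * ((q * (1 - q)) ^ card T * (\<alpha> T)\<^sup>2))
          \<le> \<tau> ^ 4 / 32 ^ d * (q * (1 - q)) ^ card S"
          using \<open>S \<subseteq> N\<close> \<open>card S \<le> d\<close> unfolding \<delta>_def s_def by simp
      qed auto
    qed
    finally show ?thesis .
  qed
  then have main: "bmean q N (\<lambda>X. (expansion q N a X)\<^sup>2) \<le> 2 * I / real d"
    by (simp add: \<tau>_def)
  have "bmean q N (\<lambda>X. (E X)\<^sup>2) \<le> 2 ^ (5 * d + 1) * \<gamma> * (\<Sum>T\<in>C. s ^ card T * (\<alpha> T)\<^sup>2)"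
    unfolding E_def s_def
  proof (rule core_chr_error[OF fN q _ sat _ pos(3)])
    show "S \<subseteq> N" if "S \<in> A" for S using A(2)[OF that] by simp
    show "T \<subseteq> N \<and> card T \<le> d \<and> core A T = T" if "T \<in> C" for T
      using that unfolding C_def by (rule CollectD)
    have "2 ^ d * \<gamma> * 2 = 2 ^ (d + 1) / 2 ^ (5 * d + 2) / real d"
      by (simp add: \<gamma>_def)
    also have "\<dots> \<le> 1"
    proof -
      have "(2::real) ^ (d + 1) \<le> 2 ^ (5 * d + 2)" by (intro power_increasing) auto
      also have "\<dots> \<le> 2 ^ (5 * d + 2) * real d" using d by simp
      finally show ?thesis using d by (simp add: divide_le_eq mult_ac)
    qed
    finally show "2 ^ d * \<gamma> * 2 \<le> 1" .
  qed
  also have "\<dots> \<le> 2 ^ (5 * d + 1) * \<gamma> * 1"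
  proof (rule mult_left_mono)
    have "(\<Sum>T\<in>C. s ^ card T * (\<alpha> T)\<^sup>2) \<le> (\<Sum>T\<in>Pow N. s ^ card T * (\<alpha> T)\<^sup>2)"
      using fN w0 by (intro sum_mono2) (auto simp: C_def)
    then show "(\<Sum>T\<in>C. s ^ card T * (\<alpha> T)\<^sup>2) \<le> 1" using one by simp
  qed (use pos in auto)
  also have "\<dots> = 1 / (2 * real d)"
    by (simp add: \<gamma>_def power_add)
  finally have err: "bmean q N (\<lambda>X. (E X)\<^sup>2) \<le> 1 / (2 * real d)" .
  have "bmean q N (\<lambda>X. (\<phi> X - g X)\<^sup>2) \<le> bmean q N (\<lambda>X. 2 * (expansion q N a X)\<^sup>2 + 2 * (E X)\<^sup>2)"
  proof (rule bmean_mono)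
    fix X assume "X \<subseteq> N"
    have "(u + v)\<^sup>2 \<le> 2 * u\<^sup>2 + 2 * v\<^sup>2" for u v :: real
      using sum_squares_bound[of u v] by (simp add: power2_sum)
    then show "(\<phi> X - g X)\<^sup>2 \<le> 2 * (expansion q N a X)\<^sup>2 + 2 * (E X)\<^sup>2"
      unfolding dec[OF \<open>X \<subseteq> N\<close>] .
  qed (use q in auto)
  also have "\<dots> = 2 * bmean q N (\<lambda>X. (expansion q N a X)\<^sup>2) + 2 * bmean q N (\<lambda>X. (E X)\<^sup>2)"
    by (simp add: bmean_add bmean_cmult)
  also have "\<dots> \<le> 2 * (2 * I / real d) + 2 * (1 / (2 * real d))"
    using main err by (intro add_mono mult_left_mono) auto
  also have "\<dots> = (4 * I + 1) / real d"
    by (simp add: add_divide_distrib)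
  finally have "bmean q N (\<lambda>X. (\<phi> X - g X)\<^sup>2) \<le> (4 * I + 1) / real d" .
  moreover have "g (core A X) = g X" for X by (simp add: g_def core_chr_core)
  moreover have "\<forall>S\<in>A. S \<subseteq> N" using A(2) by simp
  ultimately show ?thesis using size by (intro exI[of _ A] exI[of _ g] conjI allI)
qed

subsection \<open>Transfer to the product measure\<close>

text \<open>\<open>X\<close> is the set of coordinates with value \<open>b\<close>, as
  \<open>(i \<in> X) = b\<close> evaluates to \<open>b\<close> on \<open>X\<close> and to its
  negation off \<open>X\<close>. The value \<open>undefined\<close> off \<open>N\<close> matches the
  default in \<open>mu\<close>.\<close>

definition point_of :: "bool \<Rightarrow> nat set \<Rightarrow> nat set \<Rightarrow> nat \<Rightarrow> bool" where
  "point_of b N X i = (if i \<in> N then (i \<in> X) = b else undefined)"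

lemma finite_set_Pi_bernoulli:
  "finite N \<Longrightarrow> finite (set_pmf (Pi_pmf N dflt (\<lambda>_. bernoulli_pmf p)))"
  by (rule finite_subset[OF set_Pi_pmf_subset'])
    (auto intro!: finite_PiE_dflt intro: finite_subset[OF subset_UNIV])

lemma expectation_Pi_bernoulli:
  fixes \<phi> :: "nat set \<Rightarrow> real"
  assumes "finite N"
  shows "measure_pmf.expectation (Pi_pmf N undefined (\<lambda>_. bernoulli_pmf p)) (\<lambda>x. \<phi> {i\<in>N. x i = b}) =
    bmean (pmf (bernoulli_pmf p) b) N \<phi>"
  using assms
proof (induction N arbitrary: \<phi> rule: finite_induct)
  case empty
  then show ?case by simp
next
  case (insert j N)
  let ?B = "bernoulli_pmf p" and ?M = "Pi_pmf N undefined (\<lambda>_. bernoulli_pmf p)"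
  let ?q = "pmf (bernoulli_pmf p) b"
  have eq: "{i\<in>insert j N. (x(j := c)) i = b} = (if c = b then insert j {i\<in>N. x i = b} else {i\<in>N. x i = b})"
    for x c
    using insert.hyps by auto
  have E: "measure_pmf.expectation (?M \<bind> (\<lambda>x. return_pmf (x(j := c)))) (\<lambda>x. \<phi> {i\<in>insert j N. x i = b}) =
    bmean ?q N (\<lambda>X. if c = b then \<phi> (insert j X) else \<phi> X)" for c
  proof -
    have "measure_pmf.expectation (?M \<bind> (\<lambda>x. return_pmf (x(j := c)))) (\<lambda>x. \<phi> {i\<in>insert j N. x i = b}) =
      measure_pmf.expectation ?M (\<lambda>x. \<phi> {i\<in>insert j N. (x(j := c)) i = b})"
      by (simp add: map_pmf_def[symmetric])
    also have "\<dots> = measure_pmf.expectation ?M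
      (\<lambda>x. (\<lambda>X. if c = b then \<phi> (insert j X) else \<phi> X) {i\<in>N. x i = b})"
      unfolding eq by (simp add: if_distrib)
    finally show ?thesis using insert.IH by simp
  qed
  have "(\<Sum>c\<in>{b, \<not> b}. pmf ?B c) = 1"
    by (rule sum_pmf_eq_1) auto
  then have sum1: "pmf ?B b + pmf ?B (\<not> b) = 1" by simp
  have "measure_pmf.expectation (Pi_pmf (insert j N) undefined (\<lambda>_. ?B)) (\<lambda>x. \<phi> {i\<in>insert j N. x i = b}) =
    (\<Sum>c\<in>{b, \<not> b}. pmf ?B c *\<^sub>R
      measure_pmf.expectation (?M \<bind> (\<lambda>x. return_pmf (x(j := c)))) (\<lambda>x. \<phi> {i\<in>insert j N. x i = b}))"
    unfolding Pi_pmf_insert'[OF insert.hyps(1,2)]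
    by (rule pmf_expectation_bind) (auto simp: finite_set_Pi_bernoulli[OF insert.hyps(1)])
  also have "\<dots> = (\<Sum>c\<in>{b, \<not> b}. pmf ?B c *\<^sub>R bmean ?q N (\<lambda>X. if c = b then \<phi> (insert j X) else \<phi> X))"
    by (simp only: E)
  also have "\<dots> = ?q * bmean ?q N (\<lambda>X. \<phi> (insert j X)) + (1 - ?q) * bmean ?q N \<phi>"
  proof -
    have "pmf ?B (\<not> b) = 1 - ?q" using sum1 by simp
    then show ?thesis by simp
  qed
  finally show ?case
    by (simp add: bmean_insert[OF insert.hyps(1,2)] bmean_add bmean_cmult)
qed

lemma expectation_mu:
  fixes h :: "(nat \<Rightarrow> bool) \<Rightarrow> real"
  shows "measure_pmf.expectation (mu p n) h =
    bmean (pmf (bernoulli_pmf p) b) {1..n} (\<lambda>X. h (point_of b {1..n} X))"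
proof -
  \<comment> \<open>Points of the support take the default value outside \<open>{1..n}\<close>, so
    they are recovered from their set of coordinates with value \<open>b\<close>.\<close>
  have pt: "point_of b {1..n} {i\<in>{1..n}. x i = b} = x" if "x \<in> set_pmf (mu p n)" for x
  proof
    fix i
    have "x i = undefined" if "i \<notin> {1..n}"
      using set_Pi_pmf_subset[of "{1..n}" undefined] \<open>x \<in> set_pmf (mu p n)\<close> that unfolding mu_def by blast
    then show "point_of b {1..n} {i\<in>{1..n}. x i = b} i = x i" by (auto simp: point_of_def)
  qed
  have "measure_pmf.expectation (mu p n) h =
    measure_pmf.expectation (mu p n) (\<lambda>x. h (point_of b {1..n} {i\<in>{1..n}. x i = b}))"
  proof (rule integral_cong_AE)
    show "AE x in mu p n. h x = h (point_of b {1..n} {i\<in>{1..n}. x i = b})"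
      unfolding AE_measure_pmf_iff by (intro ballI) (simp only: pt)
  qed simp_all
  also have "\<dots> = bmean (pmf (bernoulli_pmf p) b) {1..n} (\<lambda>X. h (point_of b {1..n} X))"
    unfolding mu_def by (rule expectation_Pi_bernoulli) simp
  finally show ?thesis .
qed

lemma expectation_pair_pmf_finite:
  fixes h :: "'a \<times> 'b \<Rightarrow> real"
  assumes "finite (set_pmf A)" "finite (set_pmf B)"
  shows "measure_pmf.expectation (pair_pmf A B) h =
    measure_pmf.expectation A (\<lambda>x. measure_pmf.expectation B (\<lambda>y. h (x, y)))"
proof -
  have "measure_pmf.expectation (pair_pmf A B) h =
    (\<Sum>x\<in>set_pmf A. pmf A x *\<^sub>R measure_pmf.expectation (map_pmf (Pair x) B) h)"
    using assms unfolding pair_pmf_def map_pmf_def by (intro pmf_expectation_bind) auto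
  also have "\<dots> = measure_pmf.expectation A (\<lambda>x. measure_pmf.expectation B (\<lambda>y. h (x, y)))"
    using assms by (subst integral_measure_pmf[of "set_pmf A"]) auto
  finally show ?thesis .
qed

lemma influence_eq_bmean:
  fixes p :: real
  assumes j: "j \<in> {1..n}"
  shows "influence p n f j =
    bmean (pmf (bernoulli_pmf p) b) {1..n} (local_var (pmf (bernoulli_pmf p) b) (\<lambda>X. of_bool (f (point_of b {1..n} X))) j)"
proof -
  let ?q = "pmf (bernoulli_pmf p) b" and ?N = "{1..n}" and ?E = "measure_pmf.expectation (mu p n)"
  have fin: "finite (set_pmf (mu p n))" unfolding mu_def by (rule finite_set_Pi_bernoulli) simp
  have "influence p n f j = measure_pmf.expectation (pair_pmf (mu p n) (mu p n))
    (indicator {(x, y). f x \<noteq> f (x(j := y j))})"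
    unfolding influence_def by simp
  also have "\<dots> = ?E (\<lambda>x. ?E (\<lambda>y. of_bool (f x \<noteq> f (x(j := y j)))))"
    unfolding expectation_pair_pmf_finite[OF fin fin] by (simp add: indicator_def)
  also have "\<dots> = bmean ?q ?N (\<lambda>X. ?E (\<lambda>y. of_bool (f (point_of b ?N X) \<noteq> f ((point_of b ?N X)(j := y j)))))"
    by (rule expectation_mu)
  also have "\<dots> = bmean ?q ?N (local_var ?q (\<lambda>X. of_bool (f (point_of b ?N X))) j)"
  proof (rule bmean_cong)
    fix X
    let ?x = "point_of b ?N X"
    have ins: "?x(j := b) = point_of b ?N (insert j X)" "?x(j := \<not> b) = point_of b ?N (X - {j})"
      using j by (auto simp: point_of_def fun_eq_iff)
    have 1: "?E (\<lambda>y. of_bool (f ?x \<noteq> f (?x(j := y j)))) =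
      bmean ?q ?N (\<lambda>Y. of_bool (f ?x \<noteq> f (?x(j := (j \<in> Y) = b))))"
      using j by (simp add: expectation_mu[where b = b] point_of_def)
    have ind: "bmean ?q ?N (\<lambda>Y. of_bool ({j} \<subseteq> Y)) = ?q"
      using bmean_indicator[of ?N "{j}" ?q] j by simp
    \<comment> \<open>The integrand depends on \<open>Y\<close> only through
      \<open>j \<in> Y\<close>, hence is affine in that indicator, whose mean is
      \<open>?q\<close>.\<close>
    have "bmean ?q ?N (\<lambda>Y. of_bool (f ?x \<noteq> f (?x(j := (j \<in> Y) = b)))) =
      bmean ?q ?N (\<lambda>Y. of_bool (f ?x \<noteq> f (?x(j := \<not> b))) +
      (of_bool (f ?x \<noteq> f (?x(j := b))) - of_bool (f ?x \<noteq> f (?x(j := \<not> b)))) * of_bool ({j} \<subseteq> Y))"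
      by (rule bmean_cong) (simp add: of_bool_def)
    also have "\<dots> = of_bool (f ?x \<noteq> f (?x(j := \<not> b))) +
      (of_bool (f ?x \<noteq> f (?x(j := b))) - of_bool (f ?x \<noteq> f (?x(j := \<not> b)))) * ?q"
      by (simp only: bmean_add bmean_cmult ind bmean_const[OF finite_atLeastAtMost])
    finally have 2: "bmean ?q ?N (\<lambda>Y. of_bool (f ?x \<noteq> f (?x(j := (j \<in> Y) = b)))) = \<dots>" .
    show "?E (\<lambda>y. of_bool (f ?x \<noteq> f (?x(j := y j)))) =
      local_var ?q (\<lambda>X. of_bool (f (point_of b ?N X))) j X"
      unfolding 1 2 unfolding ins local_var_def
      by (cases "f ?x"; cases "f (point_of b ?N (insert j X))"; cases "f (point_of b ?N (X - {j}))")
        (simp_all only: of_bool_def, simp_all)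
  qed
  finally show ?thesis .
qed

text \<open>Rounding \<open>g\<close> at \<open>1 / 2\<close> errs only where \<open>g\<close> is at
  distance at least \<open>1 / 2\<close> from the true value. So the error in the 1-norm is at most
  4 times the mean square error.\<close>

lemma pseudo_junta_round:
  fixes p k \<epsilon> :: real and g :: "nat set \<Rightarrow> real"
  assumes p: "0 \<le> p" "p \<le> 1" and k: "0 < k"
    and A: "\<And>S. S \<in> A \<Longrightarrow> S \<subseteq> {1..n}" and g: "\<And>X. g (core A X) = g X"
    and size: "bmean (pmf (bernoulli_pmf p) b) {1..n} (\<lambda>X. real (card (core A X))) \<le> k"
    and err: "bmean (pmf (bernoulli_pmf p) b) {1..n} (\<lambda>X. (of_bool (f (point_of b {1..n} X)) - g X)\<^sup>2) \<le> \<epsilon> / 4"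
  shows "\<exists>h. pseudo_junta p n k h \<and>
    measure_pmf.expectation (mu p n) (\<lambda>x. \<bar>of_bool (f x) - of_bool (h x)\<bar>) \<le> \<epsilon>"
proof -
  let ?q = "pmf (bernoulli_pmf p) b" and ?N = "{1..n}"
  \<comment> \<open>With this choice the junta set at the point encoded by \<open>X\<close> is
    \<open>core A X\<close>.\<close>
  define J where "J S y \<longleftrightarrow> S \<in> A \<and> (\<forall>i\<in>S. y i = b)" for S and y :: "nat \<Rightarrow> bool"
  define h where "h x \<longleftrightarrow> 1 / 2 \<le> g (junta_set n J x)" for x
  have js: "junta_set n J (point_of b ?N X) = core A X" for X
  proof -
    have pb: "point_of b ?N X i = b \<longleftrightarrow> i \<in> X" if "i \<in> ?N" for i
      using that by (auto simp: point_of_def)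
    have "J S (restrict (point_of b ?N X) S) \<longleftrightarrow> S \<in> A \<and> (\<forall>i\<in>S. point_of b ?N X i = b)" for S
      by (simp add: J_def)
    then have "S \<subseteq> ?N \<and> J S (restrict (point_of b ?N X) S) \<longleftrightarrow> S \<in> A \<and> S \<subseteq> X" for S
      using A[of S] pb by blast
    then show ?thesis by (simp add: junta_set_def core_def)
  qed
  have "h \<in> measurable (junta_algebra n J) (count_space UNIV)"
  proof -
    let ?F = "\<lambda>x. (junta_set n J x, restrict x (junta_set n J x))"
    have "?F \<in> measurable (junta_algebra n J) (count_space (SIGMA S:Pow ?N. cube S))"
      unfolding junta_algebra_def
      by (rule measurable_vimage_algebra1) (auto simp: junta_set_def cube_def)
    \<comment> \<open>The rounded function reads only the first component, the junta set
      itself.\<close>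
    moreover have "(\<lambda>z. 1 / 2 \<le> g (fst z)) \<in> measurable (count_space (SIGMA S:Pow ?N. cube S)) (count_space UNIV)"
      by simp
    ultimately have "(\<lambda>x. 1 / 2 \<le> g (fst (?F x))) \<in> measurable (junta_algebra n J) (count_space UNIV)"
      by (rule measurable_compose)
    then show ?thesis by (simp add: h_def[abs_def])
  qed
  moreover have "measure_pmf.expectation (mu p n) (\<lambda>x. real (card (junta_set n J x))) \<le> k"
    unfolding expectation_mu[where b = b] js by (rule size)
  ultimately have "pseudo_junta p n k h"
    using k by (auto simp: pseudo_junta_def)
  moreover have "measure_pmf.expectation (mu p n) (\<lambda>x. \<bar>of_bool (f x) - of_bool (h x)\<bar>) \<le> \<epsilon>"
  proof -
    have "measure_pmf.expectation (mu p n) (\<lambda>x. \<bar>of_bool (f x) - of_bool (h x)\<bar>) =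
      bmean ?q ?N (\<lambda>X. \<bar>of_bool (f (point_of b ?N X)) - of_bool (1 / 2 \<le> g X)\<bar>)"
      unfolding expectation_mu[where b = b] h_def js g ..
    also have "\<dots> \<le> bmean ?q ?N (\<lambda>X. 4 * (of_bool (f (point_of b ?N X)) - g X)\<^sup>2)"
    proof (rule bmean_mono)
      fix X
      have "\<bar>of_bool c - of_bool (1 / 2 \<le> y)\<bar> \<le> 4 * (of_bool c - y)\<^sup>2" for c and y :: real
      proof (cases "of_bool c = (of_bool (1 / 2 \<le> y) :: real)")
        case False
        then have "1 / 2 \<le> \<bar>of_bool c - y\<bar>" by (cases c) (auto split: if_splits)
        then have "(1 / 2)\<^sup>2 \<le> \<bar>of_bool c - y\<bar>\<^sup>2" by (rule power_mono) simp
        then have "1 \<le> 4 * (of_bool c - y)\<^sup>2" by (simp add: power_divide)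
        moreover have "\<bar>of_bool c - of_bool (1 / 2 \<le> y)\<bar> \<le> (1::real)" by simp
        ultimately show ?thesis by linarith
      qed simp
      then show "\<bar>of_bool (f (point_of b ?N X)) - of_bool (1 / 2 \<le> g X)\<bar> \<le>
        4 * (of_bool (f (point_of b ?N X)) - g X)\<^sup>2" .
    qed (simp_all add: pmf_le_1)
    also have "\<dots> \<le> \<epsilon>" using err by (simp add: bmean_cmult)
    finally show ?thesis .
  qed
  ultimately show ?thesis by blast
qed

theorem theorem2p8:
  fixes p \<epsilon> :: real and n :: nat and f :: "(nat \<Rightarrow> bool) \<Rightarrow> bool"
  assumes "0 < p" and "p < 1" and "n > 0" and "\<epsilon> > 0"
  shows "\<exists>h. pseudo_junta p n
               (exp (10 ^ 10 * \<epsilon> powi (-2) * (of_int \<lceil>total_influence p n f\<rceil>)\<^sup>2)) h \<and>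
             measure_pmf.expectation (mu p n)
               (\<lambda>x. \<bar>of_bool (f x) - of_bool (h x)\<bar>) \<le> \<epsilon>"
proof -
  \<comment> \<open>The rarer bit value, so that \<open>q \<le> 1 / 2\<close>.\<close>
  define b where "b \<longleftrightarrow> p \<le> 1 / 2"
  define q where "q = pmf (bernoulli_pmf p) b"
  have "q = (if p \<le> 1 / 2 then p else 1 - p)"
    using assms by (simp add: q_def b_def)
  then have q: "0 < q" "q \<le> 1 / 2" "q < 1"
    using assms by auto
  define \<phi> :: "nat set \<Rightarrow> real" where "\<phi> X = of_bool (f (point_of b {1..n} X))" for X
  have \<phi>01: "\<phi> X \<in> {0, 1}" for X by (simp add: \<phi>_def)
  define I where "I = (\<Sum>j\<in>{1..n}. bmean q {1..n} (local_var q \<phi> j))"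
  have I: "total_influence p n f = I"
    unfolding total_influence_def I_def q_def \<phi>_def
    by (rule sum.cong) (simp_all only: influence_eq_bmean[where b = b])
  define m where "m = real_of_int \<lceil>I\<rceil>"
  define K where "K = exp (10 ^ 10 * \<epsilon> powi (-2) * m\<^sup>2)"
  have I0: "0 \<le> I"
    unfolding I_def local_var_def using q by (intro sum_nonneg bmean_nonneg) auto
  have Im: "I \<le> m" by (simp add: m_def)
  have core0: "core {} X = {}" for X :: "nat set" by (simp add: core_def)
  have K: "0 < K" "bmean q {1..n} (\<lambda>X. real (card (core {} X))) \<le> K"
    by (simp_all add: K_def core0 bmean_const)
  have "\<exists>h. pseudo_junta p n K h \<and>
    measure_pmf.expectation (mu p n) (\<lambda>x. \<bar>of_bool (f x) - of_bool (h x)\<bar>) \<le> \<epsilon>"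
  proof -
    \<comment> \<open>The first two cases use the empty family and a constant: \<open>1 / 2\<close>
      has mean square error \<open>1 / 4\<close>, and for \<open>I = 0\<close> the Poincare
      inequality applies. In the remaining case \<open>m \<ge> 1\<close> and
      \<open>m / \<epsilon> \<ge> 1\<close>, which lets additive constants be absorbed.\<close>
    consider "1 \<le> \<epsilon>" | "I = 0" | "\<epsilon> < 1" "0 < I" using I0 by linarith
    then have "\<exists>A g. (\<forall>S\<in>A. S \<subseteq> {1..n}) \<and> (\<forall>X. g (core A X) = g X) \<and>
      bmean q {1..n} (\<lambda>X. real (card (core A X))) \<le> K \<and> bmean q {1..n} (\<lambda>X. (\<phi> X - g X)\<^sup>2) \<le> \<epsilon> / 4"
    proof cases
      case 1
      have "bmean q {1..n} (\<lambda>X. (\<phi> X - 1 / 2)\<^sup>2) = bmean q {1..n} (\<lambda>X. 1 / 4)"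
        by (rule bmean_cong) (simp add: \<phi>_def power2_eq_square of_bool_def)
      then have "bmean q {1..n} (\<lambda>X. (\<phi> X - 1 / 2)\<^sup>2) \<le> \<epsilon> / 4" using 1 by (simp add: bmean_const)
      then show ?thesis using K by (intro exI[of _ "{}"] exI[of _ "\<lambda>_. 1 / 2"]) auto
    next
      case 2
      obtain c where "bmean q {1..n} (\<lambda>X. (\<phi> X - c)\<^sup>2) \<le> I"
        using constant_approximation[of "{1..n}" q \<phi>] q \<phi>01 unfolding I_def by auto
      then have "bmean q {1..n} (\<lambda>X. (\<phi> X - c)\<^sup>2) \<le> \<epsilon> / 4" using 2 assms by simp
      then show ?thesis using K by (intro exI[of _ "{}"] exI[of _ "\<lambda>_. c"]) auto
    next
      case 3
      then have m: "1 \<le> m" by (simp add: m_def)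
      \<comment> \<open>The 20 comes from \<open>4 * I + 1 \<le> 5 * m\<close> and the required
        error \<open>\<epsilon> / 4\<close>.\<close>
      define d where "d = nat \<lceil>20 * m / \<epsilon>\<rceil>"
      have me: "1 \<le> m / \<epsilon>" using m 3 assms by (simp add: le_divide_eq)
      have d: "20 * m / \<epsilon> \<le> real d" "real d \<le> 20 * m / \<epsilon> + 1"
        using m assms unfolding d_def by (auto simp: of_nat_nat)
      then have d1: "1 \<le> d" using me by simp
      have "\<exists>A g. (\<forall>S\<in>A. S \<subseteq> {1..n}) \<and> (\<forall>X. g (core A X) = g X) \<and>
        bmean q {1..n} (\<lambda>X. real (card (core A X))) \<le> exp (23 * (real d)\<^sup>2) \<and>
        bmean q {1..n} (\<lambda>X. (\<phi> X - g X)\<^sup>2) \<le> (4 * I + 1) / real d"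
        unfolding I_def by (rule junta_approximation[OF finite_atLeastAtMost q(1,2) d1 \<phi>01])
      moreover have "exp (23 * (real d)\<^sup>2) \<le> K"
      proof -
        \<comment> \<open>Rounding up costs at most 1, hence at most one further
          \<open>m / \<epsilon>\<close>; the exponent constant is
          \<open>23 * 441 = 10143\<close>.\<close>
        have "(real d)\<^sup>2 \<le> (21 * (m / \<epsilon>))\<^sup>2" using d me by (intro power_mono) auto
        also have "\<dots> = 441 * (\<epsilon> powi (-2) * m\<^sup>2)"
          by (simp add: power_int_minus power_divide power_mult_distrib field_simps)
        finally have "23 * (real d)\<^sup>2 \<le> 10143 * (\<epsilon> powi (-2) * m\<^sup>2)" by linarith
        also have "\<dots> \<le> 10 ^ 10 * (\<epsilon> powi (-2) * m\<^sup>2)"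
          using assms by (intro mult_right_mono) auto
        finally show ?thesis by (simp only: K_def exp_le_cancel_iff mult.assoc)
      qed
      moreover have "(4 * I + 1) / real d \<le> \<epsilon> / 4"
      proof -
        have "4 * I + 1 \<le> 5 * m" using Im m by simp
        also have "\<dots> \<le> \<epsilon> / 4 * real d" using d(1) assms by (simp add: field_simps)
        finally show ?thesis using d1 by (simp add: divide_le_eq)
      qed
      ultimately show ?thesis by (meson order.trans)
    qed
    then obtain A g where A: "\<forall>S\<in>A. S \<subseteq> {1..n}" "\<forall>X. g (core A X) = g X"
      "bmean q {1..n} (\<lambda>X. real (card (core A X))) \<le> K" "bmean q {1..n} (\<lambda>X. (\<phi> X - g X)\<^sup>2) \<le> \<epsilon> / 4"
      by (elim exE conjE)
    from A(1,2) show ?thesis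
      by (intro pseudo_junta_round[OF _ _ K(1) _ _ A(3,4)[unfolded q_def \<phi>_def]])
        (use assms in auto)
  qed
  then show ?thesis by (simp add: K_def m_def I)
qed

end
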